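(* Let $L$ be a logic with a normalised semantic specification $S_L$, and let $T_L$ be the tableau calculus generated from $S_L$. Then $T_L$ is sound for $L$; that is, for every (possibly infinite) set of concepts $\mathcal S$ that is satisfiable in an $L$-model, every finished tableau derivation $T_L(\mathcal S)$ is open.
   Context: **Object language.** Fix sorts $0,1,\dots,N$ (sort $1$ is primary). An object language $\mathcal L$ is given by a countable set of connectives, each $\sigma$ with a sort $(i_1,\dots,i_m,i_{m+1})$, $m\ge 0$, and by countable sets of variables $p^i_j$ and constants $q^i_j$ for each sort $i$. $\mathcal L^i$ is the smallest set containing the variables and constants of sort $i$ and containing $\sigma(E_1,\dots,E_m)$ whenever $\sigma$ has sort $(i_1,\dots,i_m,i)$ and $E_k\in\mathcal L^{i_k}$. $\mathcal L=\bigcup_i\mathcal L^i$ is the set of expressions; variables and constants are atomic; elements of $\mathcal L^0$ are individuals and of $\mathcal L^1$ concepts. $E(p_1,\dots,p_m)$ indicates variables of $E$, and $E(E_1,\dots,E_m)$ the result of uniform substitution. **Meta-language.** $FO(\mathcal L)$ is a many-sorted first-order language with sorts $0,\dots,N$ and a further domain sort $N+1$. Expressions of sort $i\le N$ are terms of sort $i$ (connectives are function symbols). There are also domain variables, domain constants, function symbols with values of domain sort, constant predicate symbols $P$ with arguments of domain sort, a function symbol $\nu_0$ from sort $0$ to the domain sort, predicate symbols $\nu_n$ ($1\le n\le N$) taking one argument of sort $n$ and $n$ arguments of domain sort, and equality $\approx$ on every sort (treated as an ordinary constant predicate symbol). An $\mathcal L$-open sentence is a formula in which all occurrences of variables of sorts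 $0,\dots,N$ are free and no domain variable is free. $\forall S$ is the set of universal closures of the members of $S$. **Structures.** An $\mathcal L$-structure $\mathcal I$ is a first-order interpretation of $FO(\mathcal L)$ in which sort $i\le N$ is interpreted by $\mathcal L^i$ itself (connectives as term formation) and the domain sort by a non-empty set $\Delta^{\mathcal I}$; so $\nu_0^{\mathcal I}(\ell)\in\Delta^{\mathcal I}$, $\nu_n^{\mathcal I}\subseteq\mathcal L^n\times(\Delta^{\mathcal I})^n$, $P^{\mathcal I}\subseteq(\Delta^{\mathcal I})^m$. **Semantic specification.** A semantic specification of $\mathcal L$ is a set $S$ of $\mathcal L$-open sentences, containing the usual equality axioms for $\approx$ (reflexivity, symmetry, transitivity, congruence for all $P$, $\nu_n$ and functions in domain arguments), which defines every connective: for each $\sigma$ of sort $(i_1,\dots,i_m,n)$ there is a formula $\phi^\sigma$ not containing $\sigma$ with $\forall S\models\forall\overline p\,\forall\overline x\,(\nu_n(\sigma(\overline p),\overline x)\equiv\phi^\sigma(\overline p,\overline x))$. It is normalised if $S=S^+\cup S^-\cup S^b$ (disjoint), where $S^+$ consists of sentences $\xi^E_+=\forall\overline x\,(\nu_n(E(\overline p),\overline x)\to\phi^E_+(\overline p,\overline x))$, $S^-$ of sentences $\xi^E_-=\forall\overline x\,(\phi^E_-(\overline p,\overline x)\to\nu_n(E(\overline p),\overline x))$ (at most one of each kind for each expression $E$), and all $\mathcal L$-expressions occurring in $S^b$ (the background theory, which includes the equality axioms) are atomic. **Logic, models.** A logic $L$ is a set of concepts closed under substitution; $S_L$ is a semantic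 specification of $L$ if $L$ is the set of concepts $C$ such that $\forall x\,\nu_1(C,x)$ holds (each variable and constant of $\mathcal L$ denoting itself) in all $\mathcal L$-structures satisfying $\forall S_L$. An $L$-model is an $\mathcal L$-structure satisfying $\forall S_L$. A set $\mathcal S$ of concepts is satisfiable in an $L$-model $\mathcal I$ if some $a\in\Delta^{\mathcal I}$ has $(C,a)\in\nu_1^{\mathcal I}$ for all $C\in\mathcal S$. **Tableaux.** A tableau calculus is a set of rules $X_0/X_1\mid\cdots\mid X_n$ with $X_i$ finite non-empty sets of literals of $FO(\mathcal L)$; if $n=0$ it is a closure rule, written $X_0/\bot$. A tableau is a finitely branching tree of sets of formulae; for an input set $\mathcal S$ of concepts the root is $\{\nu_1(C,a)\mid C\in\mathcal S\}$ with $a$ a fresh domain constant. A rule is applicable to a node if an instance of all its premises lies in the node ($\mathcal L$-variables are instantiated by expressions, domain variables by ground domain terms); it creates $n$ successors, the $i$-th adding the corresponding instance of $X_i$; each rule is applied at most once to the same premises. $T(\mathcal S)$ denotes a finished tableau (all applicable rules have been applied on all branches, in the limit). A branch is a maximal path, identified with the union of its nodes; it is closed if a closure rule has been applied on it, otherwise open. A tableau is closed if all its branches are closed, otherwise open. **The generated calculus $T_L$** consists of: (t1) for each $\xi^E_+\in S_L^+$: Skolemise and rewrite to $\forall\overline x(\nu_n(E(\overline p),\overline x)\to\bigvee_{j=1}^J\bigwedge_{k=1}^{K_j}\psi_{jk})$ with literals $\psi_{jk}$, and take the rule with premises $\nu_n(E(\overline p),\overline x),\,y_1\approx y_1,\dots,y_s\approx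 y_s$ (the $y_i$ being the free variables of the $\psi_{jk}$ not among $\overline x$) and denominators $\{\psi_{j1},\dots,\psi_{jK_j}\}$, $j=1,\dots,J$; for each $\xi^E_-\in S_L^-$ do the same with the contrapositive $\forall\overline x(\neg\nu_n(E(\overline p),\overline x)\to\bigvee_j\bigwedge_k\psi_{jk})$ and main premise $\neg\nu_n(E(\overline p),\overline x)$; (t2) for each non-equality sentence of $S_L^b$, rewritten in Skolemised disjunctive form $\forall\overline x\bigvee_j\bigwedge_k\psi_{jk}(\overline p,\overline x)$: the rule with premises $p_i\approx p_i$, $x_i\approx x_i$ (all variables occurring) and denominators $\{\psi_{j1},\dots,\psi_{jK_j}\}$; (t3) equality rules, for all predicates $P$ (including $\approx$), $\nu_n$ and functions $f$ (including Skolem functions) involved: $(\neg)P(\overline x)/x_1\approx x_1,\dots,x_n\approx x_n$; $(\neg)\nu_n(p,\overline x)/p\approx p,x_1\approx x_1,\dots,x_n\approx x_n$; $x\approx y/y\approx x$; $x\approx y,\,y\approx z/x\approx z$; $P(\overline x),x_i\approx y_i/P(\dots,y_i,\dots)$; $\nu_n(p,\overline x),x_i\approx y_i/\nu_n(p,\dots,y_i,\dots)$; $f(\overline p,\overline x)\approx f(\overline p,\overline x),\,x_i\approx y_i/f(\overline p,\overline x)\approx f(\overline p,\dots,y_i,\dots)$; (t4) closure rules $\nu_n(p,\overline x),\neg\nu_n(p,\overline x)/\bot$ and $P(\overline x),\neg P(\overline x)/\bot$. *)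

theory Defs
  imports Main "HOL-Library.Countable_Set" "HOL-Library.Sublist"
begin

section \<open>Object language\<close>

text \<open>
  \<open>EVar i j\<close> and \<open>ECon i j\<close> are the variable \<open>p\<close> and the constant \<open>q\<close> of sort \<open>i\<close> with index \<open>j\<close>.
  Every natural number is the index of a variable of each sort; the constants of sort \<open>i\<close> are those
  whose index lies in \<open>oconsts \<L> i\<close>.
\<close>

datatype (conns_exp: 'c) exp =
  EVar nat nat | ECon nat nat | EApp 'c "'c exp list"

text \<open>
  \<open>csort c = ([i\<^sub>1, ..., i\<^sub>m], n)\<close> is the sort of the connective \<open>c\<close>.  The object sorts are
  \<open>0, ..., maxsort\<close>; the domain sort is kept apart as the separate type of domain terms below.
  \<open>fsort f = ([i\<^sub>1, ..., i\<^sub>l], k)\<close> means that \<open>f(ps, xs)\<close> takes object arguments \<open>ps\<close> of sorts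
  \<open>i\<^sub>1, ..., i\<^sub>l\<close>, followed by \<open>k\<close> domain arguments \<open>xs\<close>, and has a value of domain sort;
  domain constants have \<open>fsort f = ([], 0)\<close>.
\<close>

record ('c, 'f, 'p) lang =
  maxsort :: nat
  conns :: "'c set"
  csort :: "'c \<Rightarrow> nat list \<times> nat"
  oconsts :: "nat \<Rightarrow> nat set"
  dfuns :: "'f set"
  fsort :: "'f \<Rightarrow> nat list \<times> nat"
  preds :: "'p set"
  parity :: "'p \<Rightarrow> nat"

definition language :: "('c, 'f, 'p) lang \<Rightarrow> bool" where
  "language \<L> \<longleftrightarrow> 1 \<le> maxsort \<L> \<and> countable (conns \<L>)
     \<and> (\<forall>c\<in>conns \<L>. (\<forall>i\<in>set (fst (csort \<L> c)). i \<le> maxsort \<L>) \<and> snd (csort \<L> c) \<le> maxsort \<L>)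
     \<and> (\<forall>f\<in>dfuns \<L>. \<forall>i\<in>set (fst (fsort \<L> f)). i \<le> maxsort \<L>)"

inductive is_expr :: "('c, 'f, 'p) lang \<Rightarrow> nat \<Rightarrow> 'c exp \<Rightarrow> bool" for \<L> where
  var: "i \<le> maxsort \<L> \<Longrightarrow> is_expr \<L> i (EVar i j)"
| const: "i \<le> maxsort \<L> \<Longrightarrow> j \<in> oconsts \<L> i \<Longrightarrow> is_expr \<L> i (ECon i j)"
| app: "c \<in> conns \<L> \<Longrightarrow> csort \<L> c = (is, i) \<Longrightarrow> length Es = length is \<Longrightarrow>
        (\<forall>k<length is. is_expr \<L> (is ! k) (Es ! k)) \<Longrightarrow> is_expr \<L> i (EApp c Es)"

definition exprs :: "('c, 'f, 'p) lang \<Rightarrow> nat \<Rightarrow> 'c exp set" where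
  "exprs \<L> i = {E. is_expr \<L> i E}"

abbreviation concepts :: "('c, 'f, 'p) lang \<Rightarrow> 'c exp set" where
  "concepts \<L> \<equiv> exprs \<L> 1"

fun atomic :: "'c exp \<Rightarrow> bool" where
  "atomic (EVar i j) = True"
| "atomic (ECon i j) = True"
| "atomic (EApp c Es) = False"

primrec evars :: "'c exp \<Rightarrow> (nat \<times> nat) list" where
  "evars (EVar i j) = [(i, j)]"
| "evars (ECon i j) = []"
| "evars (EApp c Es) = concat (map evars Es)"

primrec esubst :: "(nat \<Rightarrow> nat \<Rightarrow> 'c exp) \<Rightarrow> 'c exp \<Rightarrow> 'c exp" where
  "esubst s (EVar i j) = s i j"
| "esubst s (ECon i j) = ECon i j"
| "esubst s (EApp c Es) = EApp c (map (esubst s) Es)"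

definition sorted_subst :: "('c, 'f, 'p) lang \<Rightarrow> (nat \<Rightarrow> nat \<Rightarrow> 'c exp) \<Rightarrow> bool" where
  "sorted_subst \<L> s \<longleftrightarrow> (\<forall>i\<le>maxsort \<L>. \<forall>j. s i j \<in> exprs \<L> i)"

definition is_logic :: "('c, 'f, 'p) lang \<Rightarrow> 'c exp set \<Rightarrow> bool" where
  "is_logic \<L> L \<longleftrightarrow> L \<subseteq> concepts \<L> \<and> (\<forall>C\<in>L. \<forall>s. sorted_subst \<L> s \<longrightarrow> esubst s C \<in> L)"


section \<open>Meta-language\<close>

text \<open>
  Terms of object sort are the expressions; \<open>tm\<close> is the type of terms of domain sort.  Equality is
  \<open>EqO i\<close> on the object sort \<open>i\<close> and \<open>EqD\<close> on the domain sort.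
\<close>

datatype (conns_tm: 'c, funs_tm: 'f) tm =
  DV nat | Nu0 "'c exp" | Fn 'f "'c exp list" "('c, 'f) tm list"

datatype (conns_atom: 'c, funs_atom: 'f, preds_atom: 'p) atom =
  Nu nat "'c exp" "('c, 'f) tm list"
| Pred 'p "('c, 'f) tm list"
| EqO nat "'c exp" "'c exp"
| EqD "('c, 'f) tm" "('c, 'f) tm"

text \<open>\<open>FAll x\<close>, \<open>FEx x\<close> bind the domain variable \<open>DV x\<close>; \<open>FAllO i j\<close>, \<open>FExO i j\<close> bind \<open>EVar i j\<close>.\<close>

datatype (atoms: 'a) fm =
  FAtom 'a | FNeg "'a fm" | FAnd "'a fm" "'a fm" | FOr "'a fm" "'a fm" | FImp "'a fm" "'a fm"
| FAll nat "'a fm" | FEx nat "'a fm" | FAllO nat nat "'a fm" | FExO nat nat "'a fm"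

abbreviation FIff :: "'a fm \<Rightarrow> 'a fm \<Rightarrow> 'a fm" where
  "FIff \<phi> \<psi> \<equiv> FAnd (FImp \<phi> \<psi>) (FImp \<psi> \<phi>)"

type_synonym ('c, 'f, 'p) form = "('c, 'f, 'p) atom fm"

primrec wf_tm :: "('c, 'f, 'p) lang \<Rightarrow> ('c, 'f) tm \<Rightarrow> bool" where
  "wf_tm \<L> (DV x) = True"
| "wf_tm \<L> (Nu0 E) = is_expr \<L> 0 E"
| "wf_tm \<L> (Fn f Es ts) = (f \<in> dfuns \<L> \<and> list_all2 (is_expr \<L>) (fst (fsort \<L> f)) Es
     \<and> length ts = snd (fsort \<L> f) \<and> list_all (wf_tm \<L>) ts)"

primrec wf_atom :: "('c, 'f, 'p) lang \<Rightarrow> ('c, 'f, 'p) atom \<Rightarrow> bool" where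
  "wf_atom \<L> (Nu n E ts) = (1 \<le> n \<and> n \<le> maxsort \<L> \<and> is_expr \<L> n E \<and> length ts = n
     \<and> list_all (wf_tm \<L>) ts)"
| "wf_atom \<L> (Pred P ts) = (P \<in> preds \<L> \<and> length ts = parity \<L> P \<and> list_all (wf_tm \<L>) ts)"
| "wf_atom \<L> (EqO i E F) = (i \<le> maxsort \<L> \<and> is_expr \<L> i E \<and> is_expr \<L> i F)"
| "wf_atom \<L> (EqD t u) = (wf_tm \<L> t \<and> wf_tm \<L> u)"

primrec wf_form :: "('c, 'f, 'p) lang \<Rightarrow> ('c, 'f, 'p) form \<Rightarrow> bool" where
  "wf_form \<L> (FAtom a) = wf_atom \<L> a"
| "wf_form \<L> (FNeg \<phi>) = wf_form \<L> \<phi>"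
| "wf_form \<L> (FAnd \<phi> \<psi>) = (wf_form \<L> \<phi> \<and> wf_form \<L> \<psi>)"
| "wf_form \<L> (FOr \<phi> \<psi>) = (wf_form \<L> \<phi> \<and> wf_form \<L> \<psi>)"
| "wf_form \<L> (FImp \<phi> \<psi>) = (wf_form \<L> \<phi> \<and> wf_form \<L> \<psi>)"
| "wf_form \<L> (FAll x \<phi>) = wf_form \<L> \<phi>"
| "wf_form \<L> (FEx x \<phi>) = wf_form \<L> \<phi>"
| "wf_form \<L> (FAllO i j \<phi>) = (i \<le> maxsort \<L> \<and> wf_form \<L> \<phi>)"
| "wf_form \<L> (FExO i j \<phi>) = (i \<le> maxsort \<L> \<and> wf_form \<L> \<phi>)"

primrec ov_tm :: "('c, 'f) tm \<Rightarrow> (nat \<times> nat) list" where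
  "ov_tm (DV x) = []"
| "ov_tm (Nu0 E) = evars E"
| "ov_tm (Fn f Es ts) = concat (map evars Es) @ concat (map ov_tm ts)"

primrec dv_tm :: "('c, 'f) tm \<Rightarrow> nat list" where
  "dv_tm (DV x) = [x]"
| "dv_tm (Nu0 E) = []"
| "dv_tm (Fn f Es ts) = concat (map dv_tm ts)"

primrec ov_atom :: "('c, 'f, 'p) atom \<Rightarrow> (nat \<times> nat) list" where
  "ov_atom (Nu n E ts) = evars E @ concat (map ov_tm ts)"
| "ov_atom (Pred P ts) = concat (map ov_tm ts)"
| "ov_atom (EqO i E F) = evars E @ evars F"
| "ov_atom (EqD t u) = ov_tm t @ ov_tm u"

primrec dv_atom :: "('c, 'f, 'p) atom \<Rightarrow> nat list" where
  "dv_atom (Nu n E ts) = concat (map dv_tm ts)"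
| "dv_atom (Pred P ts) = concat (map dv_tm ts)"
| "dv_atom (EqO i E F) = []"
| "dv_atom (EqD t u) = dv_tm t @ dv_tm u"

primrec fov :: "('c, 'f, 'p) form \<Rightarrow> (nat \<times> nat) list" where
  "fov (FAtom a) = ov_atom a"
| "fov (FNeg \<phi>) = fov \<phi>"
| "fov (FAnd \<phi> \<psi>) = fov \<phi> @ fov \<psi>"
| "fov (FOr \<phi> \<psi>) = fov \<phi> @ fov \<psi>"
| "fov (FImp \<phi> \<psi>) = fov \<phi> @ fov \<psi>"
| "fov (FAll x \<phi>) = fov \<phi>"
| "fov (FEx x \<phi>) = fov \<phi>"
| "fov (FAllO i j \<phi>) = removeAll (i, j) (fov \<phi>)"
| "fov (FExO i j \<phi>) = removeAll (i, j) (fov \<phi>)"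

primrec fdv :: "('c, 'f, 'p) form \<Rightarrow> nat list" where
  "fdv (FAtom a) = dv_atom a"
| "fdv (FNeg \<phi>) = fdv \<phi>"
| "fdv (FAnd \<phi> \<psi>) = fdv \<phi> @ fdv \<psi>"
| "fdv (FOr \<phi> \<psi>) = fdv \<phi> @ fdv \<psi>"
| "fdv (FImp \<phi> \<psi>) = fdv \<phi> @ fdv \<psi>"
| "fdv (FAll x \<phi>) = removeAll x (fdv \<phi>)"
| "fdv (FEx x \<phi>) = removeAll x (fdv \<phi>)"
| "fdv (FAllO i j \<phi>) = fdv \<phi>"
| "fdv (FExO i j \<phi>) = fdv \<phi>"

primrec no_obj_quant :: "'a fm \<Rightarrow> bool" where
  "no_obj_quant (FAtom a) = True"
| "no_obj_quant (FNeg \<phi>) = no_obj_quant \<phi>"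
| "no_obj_quant (FAnd \<phi> \<psi>) = (no_obj_quant \<phi> \<and> no_obj_quant \<psi>)"
| "no_obj_quant (FOr \<phi> \<psi>) = (no_obj_quant \<phi> \<and> no_obj_quant \<psi>)"
| "no_obj_quant (FImp \<phi> \<psi>) = (no_obj_quant \<phi> \<and> no_obj_quant \<psi>)"
| "no_obj_quant (FAll x \<phi>) = no_obj_quant \<phi>"
| "no_obj_quant (FEx x \<phi>) = no_obj_quant \<phi>"
| "no_obj_quant (FAllO i j \<phi>) = False"
| "no_obj_quant (FExO i j \<phi>) = False"

definition open_sentence :: "('c, 'f, 'p) lang \<Rightarrow> ('c, 'f, 'p) form \<Rightarrow> bool" where
  "open_sentence \<L> \<phi> \<longleftrightarrow> wf_form \<L> \<phi> \<and> no_obj_quant \<phi> \<and> fdv \<phi> = []"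

definition oclosure :: "('c, 'f, 'p) form \<Rightarrow> ('c, 'f, 'p) form" where
  "oclosure \<phi> = foldr (\<lambda>(i, j). FAllO i j) (remdups (fov \<phi>)) \<phi>"

definition dclosure :: "('c, 'f, 'p) form \<Rightarrow> ('c, 'f, 'p) form" where
  "dclosure \<phi> = foldr FAll (remdups (fdv \<phi>)) \<phi>"

primrec exps_tm :: "('c, 'f) tm \<Rightarrow> 'c exp set" where
  "exps_tm (DV x) = {}"
| "exps_tm (Nu0 E) = {E}"
| "exps_tm (Fn f Es ts) = set Es \<union> \<Union> (set (map exps_tm ts))"

primrec exps_atom :: "('c, 'f, 'p) atom \<Rightarrow> 'c exp set" where
  "exps_atom (Nu n E ts) = insert E (\<Union> (exps_tm ` set ts))"
| "exps_atom (Pred P ts) = \<Union> (exps_tm ` set ts)"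
| "exps_atom (EqO i E F) = {E, F}"
| "exps_atom (EqD t u) = exps_tm t \<union> exps_tm u"

text \<open>
  The atom written \<open>\<nu>\<^sub>n(E, x\<^sub>1, ..., x\<^sub>n)\<close>.  As \<open>\<nu>\<^sub>0\<close> is a function symbol,
  \<open>\<nu>\<^sub>0(E, x)\<close> is read as \<open>\<nu>\<^sub>0(E) \<approx> x\<close>.
\<close>

definition nu_atom :: "nat \<Rightarrow> 'c exp \<Rightarrow> nat list \<Rightarrow> ('c, 'f, 'p) atom" where
  "nu_atom n E xs = (if n = 0 then EqD (Nu0 E) (DV (hd xs)) else Nu n E (map DV xs))"

definition nu_vars :: "nat \<Rightarrow> nat list \<Rightarrow> bool" where
  "nu_vars n xs \<longleftrightarrow> distinct xs \<and> length xs = (if n = 0 then 1 else n)"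


section \<open>Structures\<close>

text \<open>
  Object sorts and connectives are interpreted by the term algebra, so they need no field.
  Equality is interpreted, like any other predicate, by an arbitrary relation.
\<close>

record ('c, 'f, 'p, 'd) struct =
  dom :: "'d set"
  nu0I :: "'c exp \<Rightarrow> 'd"
  nuI :: "nat \<Rightarrow> ('c exp \<times> 'd list) set"
  fnI :: "'f \<Rightarrow> 'c exp list \<Rightarrow> 'd list \<Rightarrow> 'd"
  prI :: "'p \<Rightarrow> 'd list set"
  eqoI :: "nat \<Rightarrow> ('c exp \<times> 'c exp) set"
  eqdI :: "('d \<times> 'd) set"

definition lang_structure :: "('c, 'f, 'p) lang \<Rightarrow> ('c, 'f, 'p, 'd) struct \<Rightarrow> bool" where
  "lang_structure \<L> I \<longleftrightarrow> dom I \<noteq> {}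
     \<and> (\<forall>E\<in>exprs \<L> 0. nu0I I E \<in> dom I)
     \<and> (\<forall>n. 1 \<le> n \<and> n \<le> maxsort \<L> \<longrightarrow>
          nuI I n \<subseteq> exprs \<L> n \<times> {ds. length ds = n \<and> set ds \<subseteq> dom I})
     \<and> (\<forall>f\<in>dfuns \<L>. \<forall>Es ds. list_all2 (is_expr \<L>) (fst (fsort \<L> f)) Es
          \<and> length ds = snd (fsort \<L> f) \<and> set ds \<subseteq> dom I \<longrightarrow> fnI I f Es ds \<in> dom I)
     \<and> (\<forall>P\<in>preds \<L>. prI I P \<subseteq> {ds. length ds = parity \<L> P \<and> set ds \<subseteq> dom I})
     \<and> (\<forall>i\<le>maxsort \<L>. eqoI I i \<subseteq> exprs \<L> i \<times> exprs \<L> i)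
     \<and> eqdI I \<subseteq> dom I \<times> dom I"

definition assignment ::
  "('c, 'f, 'p) lang \<Rightarrow> ('c, 'f, 'p, 'd) struct \<Rightarrow> (nat \<Rightarrow> nat \<Rightarrow> 'c exp) \<Rightarrow> (nat \<Rightarrow> 'd) \<Rightarrow> bool" where
  "assignment \<L> I oa da \<longleftrightarrow> sorted_subst \<L> oa \<and> range da \<subseteq> dom I"

primrec tm_val ::
  "('c, 'f, 'p, 'd) struct \<Rightarrow> (nat \<Rightarrow> nat \<Rightarrow> 'c exp) \<Rightarrow> (nat \<Rightarrow> 'd) \<Rightarrow> ('c, 'f) tm \<Rightarrow> 'd" where
  "tm_val I oa da (DV x) = da x"
| "tm_val I oa da (Nu0 E) = nu0I I (esubst oa E)"
| "tm_val I oa da (Fn f Es ts) = fnI I f (map (esubst oa) Es) (map (tm_val I oa da) ts)"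

primrec sat_atom ::
  "('c, 'f, 'p, 'd) struct \<Rightarrow> (nat \<Rightarrow> nat \<Rightarrow> 'c exp) \<Rightarrow> (nat \<Rightarrow> 'd) \<Rightarrow> ('c, 'f, 'p) atom \<Rightarrow> bool" where
  "sat_atom I oa da (Nu n E ts) = ((esubst oa E, map (tm_val I oa da) ts) \<in> nuI I n)"
| "sat_atom I oa da (Pred P ts) = (map (tm_val I oa da) ts \<in> prI I P)"
| "sat_atom I oa da (EqO i E F) = ((esubst oa E, esubst oa F) \<in> eqoI I i)"
| "sat_atom I oa da (EqD t u) = ((tm_val I oa da t, tm_val I oa da u) \<in> eqdI I)"

primrec sat ::
  "('c, 'f, 'p) lang \<Rightarrow> ('c, 'f, 'p, 'd) struct \<Rightarrow> ('c, 'f, 'p) form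
     \<Rightarrow> (nat \<Rightarrow> nat \<Rightarrow> 'c exp) \<Rightarrow> (nat \<Rightarrow> 'd) \<Rightarrow> bool" where
  "sat \<L> I (FAtom a) oa da = sat_atom I oa da a"
| "sat \<L> I (FNeg \<phi>) oa da = (\<not> sat \<L> I \<phi> oa da)"
| "sat \<L> I (FAnd \<phi> \<psi>) oa da = (sat \<L> I \<phi> oa da \<and> sat \<L> I \<psi> oa da)"
| "sat \<L> I (FOr \<phi> \<psi>) oa da = (sat \<L> I \<phi> oa da \<or> sat \<L> I \<psi> oa da)"
| "sat \<L> I (FImp \<phi> \<psi>) oa da = (sat \<L> I \<phi> oa da \<longrightarrow> sat \<L> I \<psi> oa da)"
| "sat \<L> I (FAll x \<phi>) oa da = (\<forall>d\<in>dom I. sat \<L> I \<phi> oa (da(x := d)))"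
| "sat \<L> I (FEx x \<phi>) oa da = (\<exists>d\<in>dom I. sat \<L> I \<phi> oa (da(x := d)))"
| "sat \<L> I (FAllO i j \<phi>) oa da = (\<forall>E\<in>exprs \<L> i. sat \<L> I \<phi> (oa(i := (oa i)(j := E))) da)"
| "sat \<L> I (FExO i j \<phi>) oa da = (\<exists>E\<in>exprs \<L> i. sat \<L> I \<phi> (oa(i := (oa i)(j := E))) da)"

definition holds :: "('c, 'f, 'p) lang \<Rightarrow> ('c, 'f, 'p, 'd) struct \<Rightarrow> ('c, 'f, 'p) form \<Rightarrow> bool" where
  "holds \<L> I \<phi> \<longleftrightarrow> (\<forall>oa da. assignment \<L> I oa da \<longrightarrow> sat \<L> I \<phi> oa da)"

definition spec_model ::
  "('c, 'f, 'p) lang \<Rightarrow> ('c, 'f, 'p) form set \<Rightarrow> ('c, 'f, 'p, 'd) struct \<Rightarrow> bool" where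
  "spec_model \<L> S I \<longleftrightarrow> lang_structure \<L> I \<and> (\<forall>\<phi>\<in>S. holds \<L> I (oclosure \<phi>))"

definition satisfiable_in :: "'c exp set \<Rightarrow> ('c, 'f, 'p, 'd) struct \<Rightarrow> bool" where
  "satisfiable_in \<S> I \<longleftrightarrow> (\<exists>a\<in>dom I. \<forall>C\<in>\<S>. (C, [a]) \<in> nuI I 1)"


section \<open>Equality axioms\<close>

text \<open>
  \<open>equalities\<close> lists the equality predicates applied to two variables with given indices;
  \<open>dpreds\<close> lists the predicates as functions of their domain arguments, together with the number
  of these.
\<close>

definition equalities :: "('c, 'f, 'p) lang \<Rightarrow> (nat \<Rightarrow> nat \<Rightarrow> ('c, 'f, 'p) atom) set" where
  "equalities \<L> = {\<lambda>a b. EqO i (EVar i a) (EVar i b) | i. i \<le> maxsort \<L>}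
     \<union> {\<lambda>a b. EqD (DV a) (DV b)}"

definition dpreds :: "('c, 'f, 'p) lang \<Rightarrow> ((('c, 'f) tm list \<Rightarrow> ('c, 'f, 'p) atom) \<times> nat) set" where
  "dpreds \<L> = {(Pred P, parity \<L> P) | P. P \<in> preds \<L>}
     \<union> {(Nu n (EVar n 0), n) | n. 1 \<le> n \<and> n \<le> maxsort \<L>}
     \<union> {(\<lambda>ts. EqD (ts ! 0) (ts ! 1), 2)}"

definition xvars :: "nat \<Rightarrow> ('c, 'f) tm list" where
  "xvars k = map DV [0..<k]"

definition pvars :: "nat list \<Rightarrow> 'c exp list" where
  "pvars is = map (\<lambda>j. EVar (is ! j) j) [0..<length is]"

definition eq_axioms :: "('c, 'f, 'p) lang \<Rightarrow> ('c, 'f, 'p) form set" where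
  "eq_axioms \<L> = dclosure ` (
       {FAtom (q 0 0) | q. q \<in> equalities \<L>}
     \<union> {FImp (FAtom (q 0 1)) (FAtom (q 1 0)) | q. q \<in> equalities \<L>}
     \<union> {FImp (FAnd (FAtom (q 0 1)) (FAtom (q 1 2))) (FAtom (q 0 2)) | q. q \<in> equalities \<L>}
     \<union> {FImp (FAnd (FAtom (A (xvars k))) (FAtom (EqD (DV i) (DV k)))) (FAtom (A ((xvars k)[i := DV k])))
          | A k i. (A, k) \<in> dpreds \<L> \<and> i < k}
     \<union> {FImp (FAtom (EqD (DV i) (DV k)))
            (FAtom (EqD (Fn f (pvars is) (xvars k)) (Fn f (pvars is) ((xvars k)[i := DV k]))))
          | f is k i. f \<in> dfuns \<L> \<and> fsort \<L> f = (is, k) \<and> i < k})"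


section \<open>Semantic specifications\<close>

text \<open>
  Domains of structures are non-empty subsets of the type \<open>'d\<close>, which is an arbitrary type
  parameter.  By the Loewenheim-Skolem theorem, once \<open>'d\<close> is at least as large as the type of
  formulas, the quantifications over structures below are equivalent to quantifications over
  structures with domains of any size.
\<close>

definition defines_connective ::
  "'d itself \<Rightarrow> ('c, 'f, 'p) lang \<Rightarrow> ('c, 'f, 'p) form set \<Rightarrow> 'c \<Rightarrow> bool" where
  "defines_connective TYPE('d) \<L> S c \<longleftrightarrow> (\<exists>ps n xs \<phi>.
       csort \<L> c = (map fst ps, n) \<and> distinct ps \<and> nu_vars n xs
     \<and> wf_form \<L> \<phi> \<and> set (fov \<phi>) \<subseteq> set ps \<and> set (fdv \<phi>) \<subseteq> set xs
     \<and> c \<notin> (\<Union>a\<in>atoms \<phi>. conns_atom a)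
     \<and> (\<forall>I :: ('c, 'f, 'p, 'd) struct. spec_model \<L> S I \<longrightarrow>
          holds \<L> I (foldr (\<lambda>(i, j). FAllO i j) ps (foldr FAll xs
            (FIff (FAtom (nu_atom n (EApp c (map (\<lambda>(i, j). EVar i j) ps)) xs)) \<phi>)))))"

definition semantic_specification ::
  "'d itself \<Rightarrow> ('c, 'f, 'p) lang \<Rightarrow> ('c, 'f, 'p) form set \<Rightarrow> bool" where
  "semantic_specification TYPE('d) \<L> S \<longleftrightarrow>
     (\<forall>\<xi>\<in>S. open_sentence \<L> \<xi>) \<and> eq_axioms \<L> \<subseteq> S
     \<and> (\<forall>c\<in>conns \<L>. defines_connective TYPE('d) \<L> S c)"

definition specification_of ::
  "'d itself \<Rightarrow> ('c, 'f, 'p) lang \<Rightarrow> ('c, 'f, 'p) form set \<Rightarrow> 'c exp set \<Rightarrow> bool" where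
  "specification_of TYPE('d) \<L> S L \<longleftrightarrow> semantic_specification TYPE('d) \<L> S
     \<and> L = {C \<in> concepts \<L>. \<forall>I :: ('c, 'f, 'p, 'd) struct. spec_model \<L> S I \<longrightarrow>
             (\<forall>da. assignment \<L> I EVar da \<longrightarrow> sat \<L> I (FAll 0 (FAtom (Nu 1 C [DV 0]))) EVar da)}"

definition xi_pos :: "nat \<Rightarrow> 'c exp \<Rightarrow> nat list \<Rightarrow> ('c, 'f, 'p) form \<Rightarrow> ('c, 'f, 'p) form" where
  "xi_pos n E xs \<phi> = foldr FAll xs (FImp (FAtom (nu_atom n E xs)) \<phi>)"

definition xi_neg :: "nat \<Rightarrow> 'c exp \<Rightarrow> nat list \<Rightarrow> ('c, 'f, 'p) form \<Rightarrow> ('c, 'f, 'p) form" where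
  "xi_neg n E xs \<phi> = foldr FAll xs (FImp \<phi> (FAtom (nu_atom n E xs)))"

definition xi_parts :: "('c, 'f, 'p) lang \<Rightarrow> nat \<Rightarrow> 'c exp \<Rightarrow> nat list \<Rightarrow> ('c, 'f, 'p) form \<Rightarrow> bool" where
  "xi_parts \<L> n E xs \<phi> \<longleftrightarrow> n \<le> maxsort \<L> \<and> is_expr \<L> n E \<and> nu_vars n xs
     \<and> set (fov \<phi>) \<subseteq> set (evars E) \<and> set (fdv \<phi>) \<subseteq> set xs"

definition normalised ::
  "('c, 'f, 'p) lang \<Rightarrow> ('c, 'f, 'p) form set \<Rightarrow> ('c, 'f, 'p) form set
     \<Rightarrow> ('c, 'f, 'p) form set \<Rightarrow> ('c, 'f, 'p) form set \<Rightarrow> bool" where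
  "normalised \<L> S Sp Sn Sb \<longleftrightarrow>
       S = Sp \<union> Sn \<union> Sb \<and> Sp \<inter> Sn = {} \<and> Sp \<inter> Sb = {} \<and> Sn \<inter> Sb = {}
     \<and> (\<forall>\<xi>\<in>Sp. \<exists>n E xs \<phi>. xi_parts \<L> n E xs \<phi> \<and> \<xi> = xi_pos n E xs \<phi>)
     \<and> (\<forall>E. Uniq (\<lambda>\<xi>. \<xi> \<in> Sp \<and> (\<exists>n xs \<phi>. xi_parts \<L> n E xs \<phi> \<and> \<xi> = xi_pos n E xs \<phi>)))
     \<and> (\<forall>\<xi>\<in>Sn. \<exists>n E xs \<phi>. xi_parts \<L> n E xs \<phi> \<and> \<xi> = xi_neg n E xs \<phi>)
     \<and> (\<forall>E. Uniq (\<lambda>\<xi>. \<xi> \<in> Sn \<and> (\<exists>n xs \<phi>. xi_parts \<L> n E xs \<phi> \<and> \<xi> = xi_neg n E xs \<phi>)))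
     \<and> eq_axioms \<L> \<subseteq> Sb
     \<and> (\<forall>\<xi>\<in>Sb. \<forall>a\<in>atoms \<xi>. \<forall>E\<in>exps_atom a. atomic E)"


section \<open>Skolemisation and disjunctive form\<close>

text \<open>
  Function symbols of the language extended by Skolem functions and by the fresh constant \<open>Root\<close>
  of the initial node of a tableau.  The Skolem symbol \<open>Skol \<xi> m is k\<close> belongs to the \<open>m\<close>-th
  quantifier occurrence in the sentence \<open>\<xi>\<close>; \<open>is\<close> and \<open>k\<close> record its sort, as in \<open>fsort\<close>.
\<close>

datatype ('c, 'f, 'p) sfun = Orig 'f | Skol "('c, 'f, 'p) form" nat "nat list" nat | Root

type_synonym ('c, 'f, 'p) stm = "('c, ('c, 'f, 'p) sfun) tm"
type_synonym ('c, 'f, 'p) satom = "('c, ('c, 'f, 'p) sfun, 'p) atom"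

primrec tsubst ::
  "(nat \<Rightarrow> nat \<Rightarrow> 'c exp) \<Rightarrow> (nat \<Rightarrow> ('c, 'f) tm) \<Rightarrow> ('c, 'f) tm \<Rightarrow> ('c, 'f) tm" where
  "tsubst s t (DV x) = t x"
| "tsubst s t (Nu0 E) = Nu0 (esubst s E)"
| "tsubst s t (Fn f Es ts) = Fn f (map (esubst s) Es) (map (tsubst s t) ts)"

primrec asubst ::
  "(nat \<Rightarrow> nat \<Rightarrow> 'c exp) \<Rightarrow> (nat \<Rightarrow> ('c, 'f) tm) \<Rightarrow> ('c, 'f, 'p) atom \<Rightarrow> ('c, 'f, 'p) atom" where
  "asubst s t (Nu n E ts) = Nu n (esubst s E) (map (tsubst s t) ts)"
| "asubst s t (Pred P ts) = Pred P (map (tsubst s t) ts)"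
| "asubst s t (EqO i E F) = EqO i (esubst s E) (esubst s F)"
| "asubst s t (EqD u v) = EqD (tsubst s t u) (tsubst s t v)"

primrec (nonexhaustive) nquants :: "'a fm \<Rightarrow> nat" where
  "nquants (FAtom a) = 0"
| "nquants (FNeg \<phi>) = nquants \<phi>"
| "nquants (FAnd \<phi> \<psi>) = nquants \<phi> + nquants \<psi>"
| "nquants (FOr \<phi> \<psi>) = nquants \<phi> + nquants \<psi>"
| "nquants (FImp \<phi> \<psi>) = nquants \<phi> + nquants \<psi>"
| "nquants (FAll x \<phi>) = Suc (nquants \<phi>)"
| "nquants (FEx x \<phi>) = Suc (nquants \<phi>)"

text \<open>
  \<open>skol \<xi> b m us e \<phi>\<close> is the quantifier-free matrix obtained by Skolemising the part \<open>\<phi>\<close> of \<open>\<xi>\<close>.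
  The quantifier occurrences are numbered consecutively from \<open>m\<close>, \<open>b\<close> is the polarity,
  \<open>us\<close> are the universal variables in whose scope \<open>\<phi>\<close> lies and \<open>e\<close> gives the terms that replace
  the domain variables.  A quantifier with number \<open>m\<close> that is universal in view of the polarity has
  its variable renamed to \<open>DV m\<close>, so that distinct quantifiers get distinct variables; an existential
  one has it replaced by the Skolem term in all object variables of \<open>\<xi>\<close> and in \<open>us\<close>.
\<close>

definition sk_term :: "('c, 'f, 'p) form \<Rightarrow> nat \<Rightarrow> nat list \<Rightarrow> ('c, 'f, 'p) stm" where
  "sk_term \<xi> m us = (let ps = remdups (fov \<xi>) in
     Fn (Skol \<xi> m (map fst ps) (length us)) (map (\<lambda>(i, j). EVar i j) ps) (map DV us))"

primrec (nonexhaustive) skol ::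
  "('c, 'f, 'p) form \<Rightarrow> bool \<Rightarrow> nat \<Rightarrow> nat list \<Rightarrow> (nat \<Rightarrow> ('c, 'f, 'p) stm) \<Rightarrow> ('c, 'f, 'p) form
     \<Rightarrow> ('c, 'f, 'p) satom fm" where
  "skol \<xi> b m us e (FAtom a) = FAtom (asubst EVar e (map_atom id Orig id a))"
| "skol \<xi> b m us e (FNeg \<phi>) = FNeg (skol \<xi> (\<not> b) m us e \<phi>)"
| "skol \<xi> b m us e (FAnd \<phi> \<psi>) = FAnd (skol \<xi> b m us e \<phi>) (skol \<xi> b (m + nquants \<phi>) us e \<psi>)"
| "skol \<xi> b m us e (FOr \<phi> \<psi>) = FOr (skol \<xi> b m us e \<phi>) (skol \<xi> b (m + nquants \<phi>) us e \<psi>)"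
| "skol \<xi> b m us e (FImp \<phi> \<psi>) = FImp (skol \<xi> (\<not> b) m us e \<phi>) (skol \<xi> b (m + nquants \<phi>) us e \<psi>)"
| "skol \<xi> b m us e (FAll x \<phi>) =
     (if b then skol \<xi> b (Suc m) (us @ [m]) (e(x := DV m)) \<phi>
      else skol \<xi> b (Suc m) us (e(x := sk_term \<xi> m us)) \<phi>)"
| "skol \<xi> b m us e (FEx x \<phi>) =
     (if b then skol \<xi> b (Suc m) us (e(x := sk_term \<xi> m us)) \<phi>
      else skol \<xi> b (Suc m) (us @ [m]) (e(x := DV m)) \<phi>)"

text \<open>The matrix of a part \<open>\<phi>\<close> of \<open>\<xi>\<close> that lies in the scope of the outer universal variables \<open>xs\<close>.\<close>

definition skolem_matrix ::
  "('c, 'f, 'p) form \<Rightarrow> nat list \<Rightarrow> ('c, 'f, 'p) form \<Rightarrow> ('c, 'f, 'p) satom fm" where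
  "skolem_matrix \<xi> xs \<phi> = skol \<xi> True (Suc (Max (insert 0 (set xs)))) xs DV \<phi>"

datatype 'a lit = Pos (atom_of: 'a) | Neg (atom_of: 'a)

primrec (nonexhaustive) peval :: "('a \<Rightarrow> bool) \<Rightarrow> 'a fm \<Rightarrow> bool" where
  "peval v (FAtom a) = v a"
| "peval v (FNeg \<phi>) = (\<not> peval v \<phi>)"
| "peval v (FAnd \<phi> \<psi>) = (peval v \<phi> \<and> peval v \<psi>)"
| "peval v (FOr \<phi> \<psi>) = (peval v \<phi> \<or> peval v \<psi>)"
| "peval v (FImp \<phi> \<psi>) = (peval v \<phi> \<longrightarrow> peval v \<psi>)"

primrec leval :: "('a \<Rightarrow> bool) \<Rightarrow> 'a lit \<Rightarrow> bool" where
  "leval v (Pos a) = v a"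
| "leval v (Neg a) = (\<not> v a)"

text \<open>
  \<open>D = [X\<^sub>1, ..., X\<^sub>J]\<close> is a disjunctive form, i.e. the disjunction of the conjunctions of the \<open>X\<^sub>j\<close>,
  of the quantifier-free formula \<open>\<psi>\<close>: it uses only atoms of \<open>\<psi>\<close> and is propositionally equivalent
  to it.  Any result of rewriting \<open>\<psi>\<close> by propositional laws is admitted.
\<close>

definition disjunctive_form :: "'a lit set list \<Rightarrow> 'a fm \<Rightarrow> bool" where
  "disjunctive_form D \<psi> \<longleftrightarrow> (\<forall>X\<in>set D. X \<noteq> {} \<and> atom_of ` X \<subseteq> atoms \<psi>)
     \<and> (\<forall>v. peval v \<psi> \<longleftrightarrow> (\<exists>X\<in>set D. \<forall>l\<in>X. leval v l))"


section \<open>The generated calculus\<close>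

text \<open>The rule \<open>X\<^sub>0 / X\<^sub>1 | ... | X\<^sub>n\<close> is \<open>(X\<^sub>0, [X\<^sub>1, ..., X\<^sub>n])\<close>; closure rules are those with \<open>[]\<close>.\<close>

type_synonym ('c, 'f, 'p) rule = "('c, 'f, 'p) satom lit set \<times> ('c, 'f, 'p) satom lit set list"

definition refl_ov :: "(nat \<times> nat) set \<Rightarrow> ('c, 'f, 'p) atom lit set" where
  "refl_ov V = {Pos (EqO i (EVar i j) (EVar i j)) | i j. (i, j) \<in> V}"

definition refl_dv :: "nat set \<Rightarrow> ('c, 'f, 'p) atom lit set" where
  "refl_dv V = {Pos (EqD (DV x) (DV x)) | x. x \<in> V}"

definition ovs :: "('c, 'f, 'p) atom lit set list \<Rightarrow> (nat \<times> nat) set" where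
  "ovs D = (\<Union>X\<in>set D. \<Union>l\<in>X. set (ov_atom (atom_of l)))"

definition dvs :: "('c, 'f, 'p) atom lit set list \<Rightarrow> nat set" where
  "dvs D = (\<Union>X\<in>set D. \<Union>l\<in>X. set (dv_atom (atom_of l)))"

text \<open>
  \<open>D\<close> selects a disjunctive form for each sentence.  For \<open>\<xi>\<close> in \<open>S\<^sup>-\<close> the Skolemised consequent is the
  one of the contrapositive.
\<close>

definition pos_rules ::
  "('c, 'f, 'p) lang \<Rightarrow> ('c, 'f, 'p) form set \<Rightarrow> (('c, 'f, 'p) form \<Rightarrow> ('c, 'f, 'p) satom lit set list)
     \<Rightarrow> ('c, 'f, 'p) rule set" where
  "pos_rules \<L> Sp D = {(insert (Pos (nu_atom n E xs)) (refl_dv (dvs (D (xi_pos n E xs \<phi>)) - set xs)),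
       D (xi_pos n E xs \<phi>)) | n E xs \<phi>. xi_parts \<L> n E xs \<phi> \<and> xi_pos n E xs \<phi> \<in> Sp}"

definition neg_rules ::
  "('c, 'f, 'p) lang \<Rightarrow> ('c, 'f, 'p) form set \<Rightarrow> (('c, 'f, 'p) form \<Rightarrow> ('c, 'f, 'p) satom lit set list)
     \<Rightarrow> ('c, 'f, 'p) rule set" where
  "neg_rules \<L> Sn D = {(insert (Neg (nu_atom n E xs)) (refl_dv (dvs (D (xi_neg n E xs \<phi>)) - set xs)),
       D (xi_neg n E xs \<phi>)) | n E xs \<phi>. xi_parts \<L> n E xs \<phi> \<and> xi_neg n E xs \<phi> \<in> Sn}"

definition background_rules ::
  "('c, 'f, 'p) lang \<Rightarrow> ('c, 'f, 'p) form set \<Rightarrow> (('c, 'f, 'p) form \<Rightarrow> ('c, 'f, 'p) satom lit set list)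
     \<Rightarrow> ('c, 'f, 'p) rule set" where
  "background_rules \<L> Sb D =
     {(refl_ov (ovs (D \<xi>)) \<union> refl_dv (dvs (D \<xi>)), D \<xi>) | \<xi>. \<xi> \<in> Sb - eq_axioms \<L>}"

definition skolemised ::
  "('c, 'f, 'p) lang \<Rightarrow> ('c, 'f, 'p) form set \<Rightarrow> ('c, 'f, 'p) form set \<Rightarrow> ('c, 'f, 'p) form set
     \<Rightarrow> (('c, 'f, 'p) form \<times> ('c, 'f, 'p) satom fm) set" where
  "skolemised \<L> Sp Sn Sb =
       {(\<xi>, skolem_matrix \<xi> xs \<phi>) | \<xi> n E xs \<phi>. \<xi> \<in> Sp \<and> xi_parts \<L> n E xs \<phi> \<and> \<xi> = xi_pos n E xs \<phi>}
     \<union> {(\<xi>, skolem_matrix \<xi> xs (FNeg \<phi>)) | \<xi> n E xs \<phi>.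
          \<xi> \<in> Sn \<and> xi_parts \<L> n E xs \<phi> \<and> \<xi> = xi_neg n E xs \<phi>}
     \<union> {(\<xi>, skolem_matrix \<xi> [] \<xi>) | \<xi>. \<xi> \<in> Sb - eq_axioms \<L>}"

primrec sfsort :: "('c, 'f, 'p) lang \<Rightarrow> ('c, 'f, 'p) sfun \<Rightarrow> nat list \<times> nat" where
  "sfsort \<L> (Orig f) = fsort \<L> f"
| "sfsort \<L> (Skol \<xi> m is k) = (is, k)"
| "sfsort \<L> Root = ([], 0)"

definition skolem_lang ::
  "('c, 'f, 'p) lang \<Rightarrow> ('c, 'f, 'p) form set \<Rightarrow> ('c, 'f, 'p) form set \<Rightarrow> ('c, 'f, 'p) form set
     \<Rightarrow> ('c, ('c, 'f, 'p) sfun, 'p) lang" where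
  "skolem_lang \<L> Sp Sn Sb =
     \<lparr>maxsort = maxsort \<L>, conns = conns \<L>, csort = csort \<L>, oconsts = oconsts \<L>,
      dfuns = insert Root (Orig ` dfuns \<L>)
        \<union> (\<Union>(\<xi>, \<psi>)\<in>skolemised \<L> Sp Sn Sb. \<Union>a\<in>atoms \<psi>. funs_atom a),
      fsort = sfsort \<L>, preds = preds \<L>, parity = parity \<L>\<rparr>"

definition pred_atoms :: "('c, 'f, 'p) lang \<Rightarrow> ('c, 'f, 'p) atom set" where
  "pred_atoms \<L> = {A (xvars k) | A k. (A, k) \<in> dpreds \<L>}
     \<union> {EqO i (EVar i 0) (EVar i 1) | i. i \<le> maxsort \<L>}"

definition equality_rules :: "('c, 'f, 'p) lang
     \<Rightarrow> (('c, 'f, 'p) atom lit set \<times> ('c, 'f, 'p) atom lit set list) set" where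
  "equality_rules \<L> =
       {({s a}, [refl_ov (set (ov_atom a)) \<union> refl_dv (set (dv_atom a))]) | s a.
          s \<in> {Pos, Neg} \<and> a \<in> pred_atoms \<L> \<and> (ov_atom a \<noteq> [] \<or> dv_atom a \<noteq> [])}
     \<union> {({Pos (q 0 1)}, [{Pos (q 1 0)}]) | q. q \<in> equalities \<L>}
     \<union> {({Pos (q 0 1), Pos (q 1 2)}, [{Pos (q 0 2)}]) | q. q \<in> equalities \<L>}
     \<union> {({Pos (A (xvars k)), Pos (EqD (DV i) (DV k))}, [{Pos (A ((xvars k)[i := DV k]))}]) | A k i.
          (A, k) \<in> dpreds \<L> \<and> i < k}
     \<union> {({Pos (EqD (Fn f (pvars is) (xvars k)) (Fn f (pvars is) (xvars k))), Pos (EqD (DV i) (DV k))},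
         [{Pos (EqD (Fn f (pvars is) (xvars k)) (Fn f (pvars is) ((xvars k)[i := DV k])))}]) | f is k i.
          f \<in> dfuns \<L> \<and> fsort \<L> f = (is, k) \<and> i < k}"

definition closure_rules :: "('c, 'f, 'p) lang
     \<Rightarrow> (('c, 'f, 'p) atom lit set \<times> ('c, 'f, 'p) atom lit set list) set" where
  "closure_rules \<L> = {({Pos a, Neg a}, []) | a. a \<in> pred_atoms \<L>}"

definition generated_calculus ::
  "('c, 'f, 'p) lang \<Rightarrow> ('c, 'f, 'p) form set \<Rightarrow> ('c, 'f, 'p) form set \<Rightarrow> ('c, 'f, 'p) form set
     \<Rightarrow> ('c, 'f, 'p) rule set \<Rightarrow> bool" where
  "generated_calculus \<L> Sp Sn Sb T \<longleftrightarrow> (\<exists>D.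
       (\<forall>(\<xi>, \<psi>)\<in>skolemised \<L> Sp Sn Sb. disjunctive_form (D \<xi>) \<psi>)
     \<and> T = pos_rules \<L> Sp D \<union> neg_rules \<L> Sn D \<union> background_rules \<L> Sb D
         \<union> equality_rules (skolem_lang \<L> Sp Sn Sb) \<union> closure_rules (skolem_lang \<L> Sp Sn Sb))"


section \<open>Tableaux\<close>

type_synonym ('c, 'f, 'p) inst = "(nat \<Rightarrow> nat \<Rightarrow> 'c exp) \<times> (nat \<Rightarrow> ('c, 'f, 'p) stm)"

text \<open>Ground terms have no domain variables; object variables may occur in them, inside expressions.\<close>

definition ground_inst ::
  "('c, ('c, 'f, 'p) sfun, 'p) lang \<Rightarrow> ('c, 'f, 'p) inst \<Rightarrow> bool" where
  "ground_inst \<L>' \<sigma> \<longleftrightarrow> sorted_subst \<L>' (fst \<sigma>) \<and> (\<forall>x. wf_tm \<L>' (snd \<sigma> x) \<and> dv_tm (snd \<sigma> x) = [])"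

definition linst :: "('c, 'f, 'p) inst \<Rightarrow> ('c, 'f, 'p) satom lit \<Rightarrow> ('c, 'f, 'p) satom lit" where
  "linst \<sigma> = map_lit (asubst (fst \<sigma>) (snd \<sigma>))"

text \<open>
  Nodes are addressed by lists of numbers, \<open>v @ [k]\<close> being the successor of \<open>v\<close> with number \<open>k\<close>.
  \<open>app v\<close> is the rule applied at the node \<open>v\<close> and the instantiation used, or \<open>None\<close> if no
  rule is applied there.
\<close>

record ('c, 'f, 'p) tableau =
  nodes :: "nat list set"
  lab :: "nat list \<Rightarrow> ('c, 'f, 'p) satom lit set"
  app :: "nat list \<Rightarrow> (('c, 'f, 'p) rule \<times> ('c, 'f, 'p) inst) option"

definition root_label :: "'c exp set \<Rightarrow> ('c, 'f, 'p) satom lit set" where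
  "root_label \<S> = {Pos (Nu 1 C [Fn Root [] []]) | C. C \<in> \<S>}"

text \<open>The same premises: every single premise of the rule is instantiated in the same way.\<close>

definition same_premises ::
  "('c, 'f, 'p) rule \<Rightarrow> ('c, 'f, 'p) inst \<Rightarrow> ('c, 'f, 'p) inst \<Rightarrow> bool" where
  "same_premises r \<sigma> \<tau> \<longleftrightarrow> (\<forall>l\<in>fst r. linst \<sigma> l = linst \<tau> l)"

definition is_tableau ::
  "('c, ('c, 'f, 'p) sfun, 'p) lang \<Rightarrow> ('c, 'f, 'p) rule set \<Rightarrow> 'c exp set
     \<Rightarrow> ('c, 'f, 'p) tableau \<Rightarrow> bool" where
  "is_tableau \<L>' T \<S> t \<longleftrightarrow>
       [] \<in> nodes t \<and> lab t [] = root_label \<S>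
     \<and> (\<forall>v k. v @ [k] \<in> nodes t \<longleftrightarrow>
          v \<in> nodes t \<and> (\<exists>r \<sigma>. app t v = Some (r, \<sigma>) \<and> k < length (snd r)))
     \<and> (\<forall>v\<in>nodes t. \<forall>r \<sigma>. app t v = Some (r, \<sigma>) \<longrightarrow>
          r \<in> T \<and> ground_inst \<L>' \<sigma> \<and> linst \<sigma> ` fst r \<subseteq> lab t v
          \<and> (\<forall>k<length (snd r). lab t (v @ [k]) = lab t v \<union> linst \<sigma> ` (snd r ! k))
          \<and> (\<forall>u \<tau>. strict_prefix u v \<longrightarrow> app t u = Some (r, \<tau>) \<longrightarrow> \<not> same_premises r \<sigma> \<tau>))"

definition is_path :: "('c, 'f, 'p) tableau \<Rightarrow> nat list set \<Rightarrow> bool" where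
  "is_path t B \<longleftrightarrow> B \<subseteq> nodes t \<and> (\<forall>v\<in>B. \<forall>u. prefix u v \<longrightarrow> u \<in> B)
     \<and> (\<forall>u\<in>B. \<forall>v\<in>B. prefix u v \<or> prefix v u)"

definition is_branch :: "('c, 'f, 'p) tableau \<Rightarrow> nat list set \<Rightarrow> bool" where
  "is_branch t B \<longleftrightarrow> is_path t B \<and> (\<forall>B'. is_path t B' \<and> B \<subseteq> B' \<longrightarrow> B' = B)"

definition closed_branch :: "('c, 'f, 'p) tableau \<Rightarrow> nat list set \<Rightarrow> bool" where
  "closed_branch t B \<longleftrightarrow> (\<exists>v\<in>B. \<exists>r \<sigma>. app t v = Some (r, \<sigma>) \<and> snd r = [])"

text \<open>A closed branch cannot be extended, so only open branches have to be saturated.\<close>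

definition finished_tableau ::
  "('c, ('c, 'f, 'p) sfun, 'p) lang \<Rightarrow> ('c, 'f, 'p) rule set \<Rightarrow> 'c exp set
     \<Rightarrow> ('c, 'f, 'p) tableau \<Rightarrow> bool" where
  "finished_tableau \<L>' T \<S> t \<longleftrightarrow> is_tableau \<L>' T \<S> t
     \<and> (\<forall>B. is_branch t B \<and> \<not> closed_branch t B \<longrightarrow>
          (\<forall>r\<in>T. \<forall>\<sigma>. ground_inst \<L>' \<sigma> \<and> (\<exists>v\<in>B. linst \<sigma> ` fst r \<subseteq> lab t v) \<longrightarrow>
             (\<exists>u\<in>B. \<exists>\<tau>. app t u = Some (r, \<tau>) \<and> same_premises r \<sigma> \<tau>)))"

definition closed_tableau :: "('c, 'f, 'p) tableau \<Rightarrow> bool" where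
  "closed_tableau t \<longleftrightarrow> (\<forall>B. is_branch t B \<longrightarrow> closed_branch t B)"

abbreviation open_tableau :: "('c, 'f, 'p) tableau \<Rightarrow> bool" where
  "open_tableau t \<equiv> \<not> closed_tableau t"

end

theory Submission
  imports Defs
begin

text \<open>
  A model of the specification in which the concepts of \<open>\<S>\<close> hold at a point \<open>a\<close> guides the
  construction of an open branch: starting from the root, where the fresh constant denotes \<open>a\<close>, one
  successively picks a child all of whose literals are true.  This never gets stuck because each
  rule, closure rules included, preserves truth.

  As equality is interpreted by a congruence \<open>\<approx>\<close> only, arbitrary Skolem functions would violate the
  congruence rules for Skolem terms.  Hence the model is first replaced by its quotient, realised on
  representatives of the classes of \<open>\<approx>\<close>, which satisfies the same formulas.  In it \<open>\<approx>\<close> is the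
  identity on the domain, so that every choice of Skolem functions is compatible with it.
\<close>

section \<open>Substitution, sorts and dependence on free variables\<close>

lemma esubst_EVar [simp]: "esubst EVar E = E"
  by (induction E) (auto intro: map_idI)

lemma esubst_esubst: "esubst s (esubst r E) = esubst (\<lambda>i j. esubst s (r i j)) E"
  by (induction E) auto

lemma esubst_cong:
  "(\<And>i j. (i, j) \<in> set (evars E) \<Longrightarrow> s i j = s' i j) \<Longrightarrow> esubst s E = esubst s' E"
  by (induction E) auto

lemma is_expr_evars: "is_expr \<L> i E \<Longrightarrow> (a, b) \<in> set (evars E) \<Longrightarrow> a \<le> maxsort \<L>"
proof (induction rule: is_expr.induct)
  case (app c "is" i Es)
  then show ?case by (auto simp: in_set_conv_nth) (metis app.IH)
qed auto

lemma is_expr_esubst: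
  assumes "sorted_subst \<L> s"
  shows "is_expr \<L> i E \<Longrightarrow> is_expr \<L> i (esubst s E)"
proof (induction rule: is_expr.induct)
  case (var i j)
  then show ?case using assms by (auto simp: sorted_subst_def exprs_def)
next
  case (const i j)
  then show ?case by (auto intro: is_expr.const)
next
  case (app c "is" i Es)
  then show ?case by (auto intro!: is_expr.app)
qed

lemma wf_tm_ov: "wf_tm \<L> t \<Longrightarrow> (a, b) \<in> set (ov_tm t) \<Longrightarrow> a \<le> maxsort \<L>"
proof (induction t)
  case (Fn f Es ts)
  then show ?case
    by (auto simp: list_all_iff list_all2_conv_all_nth in_set_conv_nth)
       (metis is_expr_evars in_set_conv_nth)+
qed (auto dest: is_expr_evars)

lemma wf_atom_ov: "wf_atom \<L> A \<Longrightarrow> (a, b) \<in> set (ov_atom A) \<Longrightarrow> a \<le> maxsort \<L>"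
  by (cases A) (auto simp: list_all_iff dest: is_expr_evars wf_tm_ov)

lemma wf_form_fov: "wf_form \<L> \<phi> \<Longrightarrow> (a, b) \<in> set (fov \<phi>) \<Longrightarrow> a \<le> maxsort \<L>"
  by (induction \<phi>) (auto dest: wf_atom_ov)

lemma sorted_subst_EVar: "sorted_subst \<L> EVar"
  by (auto simp: sorted_subst_def exprs_def intro: is_expr.var)

lemma sorted_subst_upd:
  "sorted_subst \<L> s \<Longrightarrow> E \<in> exprs \<L> i \<Longrightarrow> sorted_subst \<L> (s(i := (s i)(j := E)))"
  by (auto simp: sorted_subst_def)

lemma tm_val_cong:
  assumes "\<And>i j. (i, j) \<in> set (ov_tm t) \<Longrightarrow> oa i j = oa' i j"
    and "\<And>x. x \<in> set (dv_tm t) \<Longrightarrow> da x = da' x"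
  shows "tm_val I oa da t = tm_val I oa' da' t"
  using assms
proof (induction t)
  case (Nu0 E)
  then show ?case by (auto intro!: arg_cong[where f = "nu0I I"] esubst_cong)
next
  case (Fn f Es ts)
  have "map (esubst oa) Es = map (esubst oa') Es"
    using Fn.prems by (auto intro!: esubst_cong)
  moreover have "map (tm_val I oa da) ts = map (tm_val I oa' da') ts"
  proof (rule map_cong[OF refl])
    show "tm_val I oa da t = tm_val I oa' da' t" if "t \<in> set ts" for t
      by (rule Fn.IH[OF that]) (use Fn.prems that in fastforce)+
  qed
  ultimately show ?case by (simp only: tm_val.simps)
qed auto

lemma sat_atom_cong:
  assumes "\<And>i j. (i, j) \<in> set (ov_atom a) \<Longrightarrow> oa i j = oa' i j"
    and "\<And>x. x \<in> set (dv_atom a) \<Longrightarrow> da x = da' x"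
  shows "sat_atom I oa da a = sat_atom I oa' da' a"
proof (cases a)
  case (Nu n E ts)
  have "map (tm_val I oa da) ts = map (tm_val I oa' da') ts" "esubst oa E = esubst oa' E"
    using assms Nu by (fastforce intro!: tm_val_cong esubst_cong)+
  then show ?thesis by (simp only: Nu sat_atom.simps)
next
  case (Pred P ts)
  have "map (tm_val I oa da) ts = map (tm_val I oa' da') ts"
    using assms Pred by (fastforce intro!: tm_val_cong)
  then show ?thesis by (simp only: Pred sat_atom.simps)
next
  case (EqO i E F)
  have "esubst oa E = esubst oa' E" "esubst oa F = esubst oa' F"
    using assms EqO by (fastforce intro!: esubst_cong)+
  then show ?thesis by (simp only: EqO sat_atom.simps)
next
  case (EqD t u)
  have "tm_val I oa da t = tm_val I oa' da' t" "tm_val I oa da u = tm_val I oa' da' u"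
    using assms EqD by (fastforce intro!: tm_val_cong)+
  then show ?thesis by (simp only: EqD sat_atom.simps)
qed

lemma sat_cong:
  assumes "no_obj_quant \<phi>"
    and "\<And>i j. (i, j) \<in> set (fov \<phi>) \<Longrightarrow> oa i j = oa' i j"
    and "\<And>x. x \<in> set (fdv \<phi>) \<Longrightarrow> da x = da' x"
  shows "sat \<L> I \<phi> oa da = sat \<L> I \<phi> oa' da'"
  using assms
proof (induction \<phi> arbitrary: da da')
  case (FAtom a)
  then show ?case by (auto intro!: sat_atom_cong simp del: sat_atom.simps)
next
  case (FNeg \<phi>)
  have "sat \<L> I \<phi> oa da = sat \<L> I \<phi> oa' da'" by (rule FNeg.IH) (use FNeg.prems in auto)
  then show ?case by simp
next
  case (FAnd \<phi> \<psi>)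
  have "sat \<L> I \<phi> oa da = sat \<L> I \<phi> oa' da'" by (rule FAnd.IH) (use FAnd.prems in auto)
  moreover have "sat \<L> I \<psi> oa da = sat \<L> I \<psi> oa' da'" by (rule FAnd.IH) (use FAnd.prems in auto)
  ultimately show ?case by simp
next
  case (FOr \<phi> \<psi>)
  have "sat \<L> I \<phi> oa da = sat \<L> I \<phi> oa' da'" by (rule FOr.IH) (use FOr.prems in auto)
  moreover have "sat \<L> I \<psi> oa da = sat \<L> I \<psi> oa' da'" by (rule FOr.IH) (use FOr.prems in auto)
  ultimately show ?case by simp
next
  case (FImp \<phi> \<psi>)
  have "sat \<L> I \<phi> oa da = sat \<L> I \<phi> oa' da'" by (rule FImp.IH) (use FImp.prems in auto)
  moreover have "sat \<L> I \<psi> oa da = sat \<L> I \<psi> oa' da'" by (rule FImp.IH) (use FImp.prems in auto)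
  ultimately show ?case by simp
next
  case (FAll x \<phi>)
  have "sat \<L> I \<phi> oa (da(x := d)) = sat \<L> I \<phi> oa' (da'(x := d))" for d
    by (rule FAll.IH) (use FAll.prems in auto)
  then show ?case by simp
next
  case (FEx x \<phi>)
  have "sat \<L> I \<phi> oa (da(x := d)) = sat \<L> I \<phi> oa' (da'(x := d))" for d
    by (rule FEx.IH) (use FEx.prems in auto)
  then show ?case by simp
qed auto

lemma tm_val_tsubst:
  "tm_val I oa w (tsubst s t u) = tm_val I (\<lambda>i j. esubst oa (s i j)) (\<lambda>x. tm_val I oa w (t x)) u"
proof (induction u)
  case (Fn f Es ts)
  then show ?case by (simp add: esubst_esubst comp_def cong: map_cong)
qed (auto simp: esubst_esubst)

lemma sat_atom_asubst:
  "sat_atom I oa w (asubst s t a)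
     = sat_atom I (\<lambda>i j. esubst oa (s i j)) (\<lambda>x. tm_val I oa w (t x)) a"
  by (cases a) (auto simp: esubst_esubst tm_val_tsubst comp_def)

lemma sat_foldr_FAllO:
  assumes "sat \<L> I (foldr (\<lambda>(i, j). FAllO i j) ps \<phi>) oa da"
    and "sorted_subst \<L> oa" and "\<And>i j. (i, j) \<in> set ps \<Longrightarrow> i \<le> maxsort \<L>"
  shows "sat \<L> I \<phi> oa da"
  using assms
proof (induction ps)
  case (Cons p ps)
  obtain i j where p: "p = (i, j)" by force
  have "oa i j \<in> exprs \<L> i" using Cons.prems p by (auto simp: sorted_subst_def)
  moreover have "\<forall>E\<in>exprs \<L> i.
      sat \<L> I (foldr (\<lambda>(i, j). FAllO i j) ps \<phi>) (oa(i := (oa i)(j := E))) da"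
    using Cons.prems(1) p by simp
  ultimately have "sat \<L> I (foldr (\<lambda>(i, j). FAllO i j) ps \<phi>) oa da"
    \<comment> \<open>The quantifier is instantiated with the current value \<open>oa i j\<close>,
      which leaves the assignment unchanged.\<close>
    by (metis fun_upd_triv)
  then show ?case by (rule Cons.IH) (use Cons.prems in auto)
qed simp

lemma sat_foldr_FAll:
  assumes "sat \<L> I (foldr FAll xs \<phi>) oa da" and "range da \<subseteq> dom I"
  shows "sat \<L> I \<phi> oa da"
  using assms
proof (induction xs)
  case (Cons x xs)
  have "sat \<L> I (foldr FAll xs \<phi>) oa (da(x := da x))"
    using Cons.prems by (auto simp del: fun_upd_triv)
  then show ?case using Cons by simp
qed simp

lemma holds_oclosureD:
  assumes "holds \<L> I (oclosure \<phi>)" "wf_form \<L> \<phi>" "sorted_subst \<L> oa" "range da \<subseteq> dom I"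
  shows "sat \<L> I \<phi> oa da"
  using assms sat_foldr_FAllO[of \<L> I "remdups (fov \<phi>)" \<phi> oa da] wf_form_fov[of \<L> \<phi>]
  by (auto simp: holds_def assignment_def oclosure_def)

section \<open>The congruence described by the equality axioms\<close>

text \<open>The congruence axioms exchange one argument at a time. Passing through the hybrids
  \<open>take j es @ drop j ds\<close> turns this into an exchange of all arguments; since
  \<open>R\<close> lives on \<open>D\<close>, the hybrids stay within \<open>D\<close>.\<close>

lemma replace_all:
  assumes "\<And>ds i e. length ds = k \<Longrightarrow> set ds \<subseteq> D \<Longrightarrow> i < k \<Longrightarrow> (ds ! i, e) \<in> R \<Longrightarrow> Q ds \<Longrightarrow> Q (ds[i := e])"
    and "R \<subseteq> D \<times> D" "list_all2 (\<lambda>a b. (a, b) \<in> R) ds es" "length ds = k" "Q ds"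
  shows "Q es"
proof -
  have len: "length es = k" using assms by (auto simp: list_all2_lengthD)
  have R: "(ds ! i, es ! i) \<in> R" if "i < k" for i
    using assms that by (auto simp: list_all2_conv_all_nth)
  have D: "set ds \<subseteq> D" "set es \<subseteq> D" using R assms(2,4) len by (fastforce simp: in_set_conv_nth)+
  have "Q (take j es @ drop j ds)" if "j \<le> k" for j
    using that
  proof (induction j)
    case 0
    then show ?case using assms by simp
  next
    case (Suc j)
    let ?ds = "take j es @ drop j ds"
    have "Q (?ds[j := es ! j])"
    proof (rule assms(1))
      show "length ?ds = k" using Suc assms(4) len by simp
      show "set ?ds \<subseteq> D" using D by (auto dest: in_set_takeD in_set_dropD)
      show "(?ds ! j, es ! j) \<in> R" using R[of j] Suc assms(4) len by (simp add: nth_append)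
    qed (use Suc in auto)
    moreover have "?ds[j := es ! j] = take (Suc j) es @ drop (Suc j) ds"
      using Suc assms(4) len
      by (auto simp: list_update_append take_Suc_conv_app_nth list_eq_iff_nth_eq nth_append
          nth_list_update)
    ultimately show ?case by simp
  qed
  from this[of k] show ?thesis using len assms(4) by simp
qed

lemma map_xvars [simp]: "map (tm_val J oa da) (xvars k) = map da [0..<k]"
  by (simp add: xvars_def comp_def)

text \<open>Serves to instantiate the congruence axioms: the variables below \<open>k\<close> denote
  the entries of \<open>ds\<close>, while \<open>DV k\<close> denotes the new entry
  \<open>e\<close>.\<close>

lemma map_nth_extend:
  "length ds = k \<Longrightarrow> map (\<lambda>x. if x < k then ds ! x else e) [0..<k] = ds"
  by (auto simp: list_eq_iff_nth_eq)

locale equality_model =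
  fixes \<L> :: "('c, 'f, 'p) lang" and S :: "('c, 'f, 'p) form set" and I :: "('c, 'f, 'p, 'd) struct"
  assumes model: "spec_model \<L> S I"
    and open_S: "\<xi> \<in> S \<Longrightarrow> open_sentence \<L> \<xi>"
    and eq_S: "eq_axioms \<L> \<subseteq> S"
begin

lemma struct: "lang_structure \<L> I"
  using model by (simp add: spec_model_def)

lemma sat_S: "\<xi> \<in> S \<Longrightarrow> sorted_subst \<L> oa \<Longrightarrow> range da \<subseteq> dom I \<Longrightarrow> sat \<L> I \<xi> oa da"
  using model open_S by (auto simp: spec_model_def open_sentence_def intro!: holds_oclosureD)

text \<open>The quantifiers added by \<open>dclosure\<close> are instantiated with the values that
  \<open>da\<close> already gives to their variables.\<close>

lemma sat_eq_axiom:
  assumes "dclosure \<phi> \<in> eq_axioms \<L>" "sorted_subst \<L> oa" "range da \<subseteq> dom I"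
  shows "sat \<L> I \<phi> oa da"
  using sat_S[of "dclosure \<phi>" oa da] assms eq_S sat_foldr_FAll[of \<L> I _ \<phi> oa da]
  by (auto simp: dclosure_def)

lemma eqd_subset: "eqdI I \<subseteq> dom I \<times> dom I"
  using struct by (simp add: lang_structure_def)

lemma EqD_equality: "(\<lambda>a b. EqD (DV a) (DV b)) \<in> equalities \<L>"
  by (simp add: equalities_def)

lemma EqO_equality: "i \<le> maxsort \<L> \<Longrightarrow> (\<lambda>a b. EqO i (EVar i a) (EVar i b)) \<in> equalities \<L>"
  by (auto simp: equalities_def)

lemma equality_refl:
  assumes "q \<in> equalities \<L>" "sorted_subst \<L> oa" "range da \<subseteq> dom I"
  shows "sat_atom I oa da (q 0 0)"
proof -
  have "dclosure (FAtom (q 0 0)) \<in> eq_axioms \<L>" using assms by (auto simp: eq_axioms_def)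
  from sat_eq_axiom[OF this assms(2,3)] show ?thesis by simp
qed

lemma equality_sym:
  assumes "q \<in> equalities \<L>" "sorted_subst \<L> oa" "range da \<subseteq> dom I" "sat_atom I oa da (q 0 1)"
  shows "sat_atom I oa da (q 1 0)"
proof -
  have "dclosure (FImp (FAtom (q 0 1)) (FAtom (q 1 0))) \<in> eq_axioms \<L>"
    unfolding eq_axioms_def using assms by (intro imageI) blast
  from sat_eq_axiom[OF this assms(2,3)] show ?thesis using assms by simp
qed

lemma equality_trans:
  assumes "q \<in> equalities \<L>" "sorted_subst \<L> oa" "range da \<subseteq> dom I"
    "sat_atom I oa da (q 0 1)" "sat_atom I oa da (q 1 2)"
  shows "sat_atom I oa da (q 0 2)"
proof -
  have "dclosure (FImp (FAnd (FAtom (q 0 1)) (FAtom (q 1 2))) (FAtom (q 0 2))) \<in> eq_axioms \<L>"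
    unfolding eq_axioms_def using assms by (intro imageI) blast
  from sat_eq_axiom[OF this assms(2,3)] show ?thesis using assms by simp
qed

lemma equiv_eqd: "equiv (dom I) (eqdI I)"
proof (rule equivI)
  show "refl_on (dom I) (eqdI I)"
  proof (rule refl_onI)
    show "(d, d) \<in> eqdI I" if "d \<in> dom I" for d
      using equality_refl[OF EqD_equality sorted_subst_EVar, of "\<lambda>_. d"] that by auto
  qed
  show "sym (eqdI I)"
  proof (rule symI)
    show "(e, d) \<in> eqdI I" if "(d, e) \<in> eqdI I" for d e
      \<comment> \<open>The axiom speaks about \<open>DV 0\<close> and \<open>DV 1\<close>, so the
        assignment sends these to the two elements at hand.\<close>
      using equality_sym[OF EqD_equality sorted_subst_EVar, of "\<lambda>x. if x = 0 then d else e"]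
        that eqd_subset by auto
  qed
  show "trans (eqdI I)"
  proof (rule transI)
    show "(a, c) \<in> eqdI I" if "(a, b) \<in> eqdI I" "(b, c) \<in> eqdI I" for a b c
      using equality_trans[OF EqD_equality sorted_subst_EVar,
          of "\<lambda>x. if x = 0 then a else if x = 1 then b else c"] that eqd_subset by auto
  qed
qed (rule eqd_subset)

lemma dpred_cong:
  assumes "(A, k) \<in> dpreds \<L>" "i < k" "sorted_subst \<L> oa" "range da \<subseteq> dom I"
    and "sat_atom I oa da (A (xvars k))" "(da i, da k) \<in> eqdI I"
  shows "sat_atom I oa da (A ((xvars k)[i := DV k]))"
proof -
  have "dclosure (FImp (FAnd (FAtom (A (xvars k))) (FAtom (EqD (DV i) (DV k))))
      (FAtom (A ((xvars k)[i := DV k])))) \<in> eq_axioms \<L>"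
    unfolding eq_axioms_def using assms by (intro imageI) blast
  from sat_eq_axiom[OF this assms(3,4)] show ?thesis using assms by simp
qed

lemma pred_cong:
  assumes "P \<in> preds \<L>" "ds \<in> prI I P" "list_all2 (\<lambda>a b. (a, b) \<in> eqdI I) ds es"
  shows "es \<in> prI I P"
proof (rule replace_all[where Q = "\<lambda>ds. ds \<in> prI I P"])
  show "length ds = parity \<L> P"
    using assms struct by (auto simp: lang_structure_def)
  fix ds :: "'d list" and i e
  assume *: "length ds = parity \<L> P" "set ds \<subseteq> dom I" "i < parity \<L> P" "(ds ! i, e) \<in> eqdI I"
    "ds \<in> prI I P"
  define da where "da = (\<lambda>x. if x < parity \<L> P then ds ! x else e)"
  have ds: "map da [0..<parity \<L> P] = ds" using * map_nth_extend[of ds] by (simp add: da_def)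
  have "sat_atom I EVar da (Pred P ((xvars (parity \<L> P))[i := DV (parity \<L> P)]))"
  proof (rule dpred_cong)
    show "(Pred P, parity \<L> P) \<in> dpreds \<L>" using assms(1) by (auto simp: dpreds_def)
    show "range da \<subseteq> dom I" using * eqd_subset by (force simp: da_def)
  qed (use * sorted_subst_EVar ds in \<open>auto simp: da_def\<close>)
  then show "ds[i := e] \<in> prI I P" using ds by (simp add: map_update da_def)
qed (use assms eqd_subset in auto)

lemma nu_cong:
  assumes "1 \<le> n" "n \<le> maxsort \<L>" "(E, ds) \<in> nuI I n" "list_all2 (\<lambda>a b. (a, b) \<in> eqdI I) ds es"
  shows "(E, es) \<in> nuI I n"
proof (rule replace_all[where Q = "\<lambda>ds. (E, ds) \<in> nuI I n"])
  have E: "E \<in> exprs \<L> n" and len: "length ds = n"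
    using assms struct by (auto simp: lang_structure_def)
  show "length ds = n" by (rule len)
  fix ds :: "'d list" and i e
  assume *: "length ds = n" "set ds \<subseteq> dom I" "i < n" "(ds ! i, e) \<in> eqdI I"
    "(E, ds) \<in> nuI I n"
  define da where "da = (\<lambda>x. if x < n then ds ! x else e)"
  \<comment> \<open>In \<open>dpreds\<close> the expression argument of \<open>Nu n\<close> is the
    variable \<open>EVar n 0\<close>; it has to denote \<open>E\<close>.\<close>
  define oa where "oa = EVar(n := (EVar n)(0 := E))"
  have ds: "map da [0..<n] = ds" using * map_nth_extend[of ds] by (simp add: da_def)
  have "sat_atom I oa da (Nu n (EVar n 0) ((xvars n)[i := DV n]))"
  proof (rule dpred_cong[where A = "Nu n (EVar n 0)"])
    show "(Nu n (EVar n 0), n) \<in> dpreds \<L>" using assms by (auto simp: dpreds_def)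
    show "range da \<subseteq> dom I" using * eqd_subset by (force simp: da_def)
    show "sorted_subst \<L> oa" unfolding oa_def by (rule sorted_subst_upd[OF sorted_subst_EVar E])
  qed (use * ds in \<open>auto simp: da_def oa_def\<close>)
  then show "(E, ds[i := e]) \<in> nuI I n" using ds by (simp add: map_update da_def oa_def)
qed (use assms eqd_subset in auto)

lemma fn_cong:
  assumes "f \<in> dfuns \<L>" "list_all2 (is_expr \<L>) (fst (fsort \<L> f)) Es"
    "length ds = snd (fsort \<L> f)" "list_all2 (\<lambda>a b. (a, b) \<in> eqdI I) ds es"
  shows "(fnI I f Es ds, fnI I f Es es) \<in> eqdI I"
proof -
  obtain "is" k where fs: "fsort \<L> f = (is, k)" by force
  show ?thesis
  \<comment> \<open>The property compares with the fixed value at the original \<open>ds\<close>, so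
    each single exchange is appended by transitivity.\<close>
  proof (rule replace_all[where k = k and Q = "\<lambda>es. (fnI I f Es ds, fnI I f Es es) \<in> eqdI I"])
    show "length ds = k" using assms fs by simp
    have "set ds \<subseteq> dom I"
      using assms(4) eqd_subset by (fastforce simp: list_all2_conv_all_nth in_set_conv_nth)
    then have "fnI I f Es ds \<in> dom I" using struct assms by (auto simp: lang_structure_def)
    then show "(fnI I f Es ds, fnI I f Es ds) \<in> eqdI I"
      using equiv_eqd by (auto simp: equiv_def refl_on_def)
    fix ds' :: "'d list" and i e
    assume *: "length ds' = k" "set ds' \<subseteq> dom I" "i < k" "(ds' ! i, e) \<in> eqdI I"
      "(fnI I f Es ds, fnI I f Es ds') \<in> eqdI I"
    define da where "da = (\<lambda>x. if x < k then ds' ! x else e)"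
    \<comment> \<open>The variables in \<open>pvars\<close> have pairwise distinct indices, so the
      index \<open>j\<close> alone tells which argument a variable stands for. All other variables
      denote themselves.\<close>
    define oa where "oa = (\<lambda>i j. if j < length is \<and> is ! j = i then Es ! j else EVar i j)"
    have ds: "map da [0..<k] = ds'" using * map_nth_extend[of ds'] by (simp add: da_def)
    have Es: "map (esubst oa) (pvars is) = Es"
    proof (rule nth_equalityI)
      show "length (map (esubst oa) (pvars is)) = length Es"
        using list_all2_lengthD[OF assms(2)] fs by (simp add: pvars_def)
      show "map (esubst oa) (pvars is) ! j = Es ! j" if "j < length (map (esubst oa) (pvars is))" for j
        using that by (simp add: pvars_def oa_def)
    qed
    have oa: "sorted_subst \<L> oa" using assms(2) fs
      by (auto simp: oa_def sorted_subst_def exprs_def list_all2_conv_all_nth intro: is_expr.var)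
    have da: "range da \<subseteq> dom I" using * eqd_subset by (force simp: da_def)
    have "dclosure (FImp (FAtom (EqD (DV i) (DV k)))
              (FAtom (EqD (Fn f (pvars is) (xvars k)) (Fn f (pvars is) ((xvars k)[i := DV k])))))
        \<in> eq_axioms \<L>"
      unfolding eq_axioms_def using assms(1) fs *(3) by (intro imageI) blast
    from sat_eq_axiom[OF this oa da] have "(fnI I f Es ds', fnI I f Es (ds'[i := e])) \<in> eqdI I"
      using * ds Es by (simp add: map_update) (simp add: da_def)
    then show "(fnI I f Es ds, fnI I f Es (ds'[i := e])) \<in> eqdI I"
      using *(5) equiv_eqd by (meson equiv_def transE)
  qed (use assms eqd_subset in auto)
qed

section \<open>The quotient on representatives\<close>

text \<open>The choice depends only on the class as a set, hence congruent elements get equal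
  representatives. Elements outside the domain are sent to the representative of some domain
  element, so that \<open>rep\<close> is total and the functions of the quotient never leave its
  domain, whatever their arguments.\<close>

definition rep :: "'d \<Rightarrow> 'd" where
  "rep d = (SOME e. e \<in> eqdI I `` {if d \<in> dom I then d else SOME c. c \<in> dom I})"

lemma rep_eqd: "d \<in> dom I \<Longrightarrow> (d, rep d) \<in> eqdI I"
  using equiv_class_self[OF equiv_eqd, of d] someI[of "\<lambda>e. e \<in> eqdI I `` {d}" d]
  by (simp add: rep_def)

lemma rep_in_image: "rep d \<in> rep ` dom I"
proof (cases "d \<in> dom I")
  case False
  have "(SOME c. c \<in> dom I) \<in> dom I"
    using struct by (simp add: lang_structure_def some_in_eq)
  moreover from this have "rep d = rep (SOME c. c \<in> dom I)" using False by (simp add: rep_def)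
  ultimately show ?thesis by simp
qed simp

lemma rep_in: "rep d \<in> dom I"
proof -
  obtain c where "c \<in> dom I" "rep d = rep c" using rep_in_image[of d] by auto
  then show ?thesis using rep_eqd[of c] eqd_subset by auto
qed

lemma rep_eq_iff:
  assumes "d \<in> dom I" "e \<in> dom I"
  shows "rep d = rep e \<longleftrightarrow> (d, e) \<in> eqdI I"
proof
  assume "rep d = rep e"
  then have "(d, rep e) \<in> eqdI I" "(rep e, e) \<in> eqdI I"
    using rep_eqd[of d] rep_eqd[of e] assms equiv_eqd by (auto elim: equivE dest: symD)
  then show "(d, e) \<in> eqdI I" using equiv_eqd by (meson equivE transE)
next
  assume "(d, e) \<in> eqdI I"
  then have "eqdI I `` {d} = eqdI I `` {e}" by (rule equiv_class_eq[OF equiv_eqd])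
  then show "rep d = rep e" using assms by (simp add: rep_def)
qed

lemma rep_rep [simp]: "rep (rep d) = rep d"
proof -
  obtain c where c: "c \<in> dom I" "rep d = rep c" using rep_in_image[of d] by auto
  then have "rep c = rep (rep c)" using rep_eq_iff[OF c(1) rep_in] rep_eqd by blast
  then show ?thesis using c by simp
qed

text \<open>Representatives instead of classes keep the element type \<open>'d\<close>. The
  relations are left as they are, because they are invariant under the congruence; they may still
  contain tuples outside the smaller domain, but assignments into that domain never evaluate to such
  tuples. Only domain equality is collapsed, object equality is not.\<close>

definition quot :: "('c, 'f, 'p, 'd) struct" where
  "quot = \<lparr>dom = rep ` dom I, nu0I = rep \<circ> nu0I I, nuI = nuI I, fnI = (\<lambda>f Es ds. rep (fnI I f Es ds)),
     prI = prI I, eqoI = eqoI I, eqdI = Id_on (rep ` dom I)\<rparr>"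

lemma quot_simps [simp]:
  "dom quot = rep ` dom I" "nu0I quot E = rep (nu0I I E)" "nuI quot = nuI I"
  "fnI quot f Es ds = rep (fnI I f Es ds)" "prI quot = prI I" "eqoI quot = eqoI I"
  "eqdI quot = Id_on (rep ` dom I)"
  by (simp_all add: quot_def)

lemma eqd_map_rep:
  assumes ds: "set ds \<subseteq> dom I"
  shows "list_all2 (\<lambda>a b. (a, b) \<in> eqdI I) ds (map rep ds)"
    "list_all2 (\<lambda>a b. (a, b) \<in> eqdI I) (map rep ds) ds"
proof -
  have *: "(d, rep d) \<in> eqdI I" "(rep d, d) \<in> eqdI I" if "d \<in> set ds" for d
    using that ds rep_eqd equiv_eqd by (meson equivE subsetD symE)+
  show "list_all2 (\<lambda>a b. (a, b) \<in> eqdI I) ds (map rep ds)"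
    "list_all2 (\<lambda>a b. (a, b) \<in> eqdI I) (map rep ds) ds"
    using * by (simp_all add: list_all2_conv_all_nth)
qed

text \<open>At a function symbol the arguments are replaced by their representatives; by congruence
  this moves the value only within its class, and the outer \<open>rep\<close> removes the
  difference.\<close>

lemma tm_val_quot:
  assumes "sorted_subst \<L> oa" "range da \<subseteq> dom I"
  shows "wf_tm \<L> t \<Longrightarrow> tm_val I oa da t \<in> dom I
    \<and> tm_val quot oa (\<lambda>x. rep (da x)) t = rep (tm_val I oa da t)"
proof (induction t)
  case (DV x)
  then show ?case using assms by auto
next
  case (Nu0 E)
  then show ?case
    using is_expr_esubst[OF assms(1)] struct by (auto simp: lang_structure_def exprs_def)
next
  case (Fn f Es ts)
  let ?vs = "map (tm_val I oa da) ts" and ?Es = "map (esubst oa) Es"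
  have vs: "set ?vs \<subseteq> dom I" and eq: "map (tm_val quot oa (\<lambda>x. rep (da x))) ts = map rep ?vs"
    using Fn by (auto simp: list_all_iff)
  have Es: "list_all2 (is_expr \<L>) (fst (fsort \<L> f)) ?Es"
    using Fn.prems is_expr_esubst[OF assms(1)] by (auto simp: list_all2_conv_all_nth)
  have len: "length ?vs = snd (fsort \<L> f)" and f: "f \<in> dfuns \<L>" using Fn.prems by auto
  have fv: "fnI I f ?Es ?vs \<in> dom I"
    using struct f Es len vs unfolding lang_structure_def by blast
  have "(fnI I f ?Es ?vs, fnI I f ?Es (map rep ?vs)) \<in> eqdI I"
    by (rule fn_cong[OF f Es len eqd_map_rep(1)[OF vs]])
  then have "rep (fnI I f ?Es (map rep ?vs)) = rep (fnI I f ?Es ?vs)"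
    using rep_eq_iff eqd_subset by (metis mem_Sigma_iff subsetD)
  with fv show ?case by (simp only: tm_val.simps eq quot_simps simp_thms)
qed

text \<open>Each relation is invariant under exchanging arguments for their representatives, in both
  directions, and congruence of two values is equality of their representatives.\<close>

lemma sat_atom_quot:
  assumes "sorted_subst \<L> oa" "range da \<subseteq> dom I" "wf_atom \<L> a"
  shows "sat_atom quot oa (\<lambda>x. rep (da x)) a = sat_atom I oa da a"
proof -
  note q = tm_val_quot[OF assms(1,2)]
  have vs: "set (map (tm_val I oa da) ts) \<subseteq> dom I"
      "map (tm_val quot oa (\<lambda>x. rep (da x))) ts = map rep (map (tm_val I oa da) ts)"
    if "list_all (wf_tm \<L>) ts" for ts
    using q that by (auto simp: list_all_iff)
  show ?thesis
  proof (cases a)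
    case (Nu n E ts)
    then have n: "1 \<le> n" "n \<le> maxsort \<L>" and ts: "list_all (wf_tm \<L>) ts" using assms(3) by auto
    have "(esubst oa E, map rep (map (tm_val I oa da) ts)) \<in> nuI I n
        \<longleftrightarrow> (esubst oa E, map (tm_val I oa da) ts) \<in> nuI I n"
      using nu_cong[OF n] eqd_map_rep[OF vs(1)[OF ts]] by blast
    then show ?thesis by (simp only: Nu sat_atom.simps vs(2)[OF ts] quot_simps)
  next
    case (Pred P ts)
    then have P: "P \<in> preds \<L>" and ts: "list_all (wf_tm \<L>) ts" using assms(3) by auto
    have "map rep (map (tm_val I oa da) ts) \<in> prI I P \<longleftrightarrow> map (tm_val I oa da) ts \<in> prI I P"
      using pred_cong[OF P] eqd_map_rep[OF vs(1)[OF ts]] by blast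
    then show ?thesis by (simp only: Pred sat_atom.simps vs(2)[OF ts] quot_simps)
  next
    case (EqO i E F)
    then show ?thesis by simp
  next
    case (EqD t u)
    then have "tm_val I oa da t \<in> dom I" "tm_val I oa da u \<in> dom I"
      "tm_val quot oa (\<lambda>x. rep (da x)) t = rep (tm_val I oa da t)"
      "tm_val quot oa (\<lambda>x. rep (da x)) u = rep (tm_val I oa da u)"
      using q assms(3) by auto
    then show ?thesis using rep_eq_iff by (auto simp: EqD Id_on_iff)
  qed
qed

text \<open>Every element of the quotient is \<open>rep d\<close> for some \<open>d\<close> in the
  old domain, so a quantifier over the quotient can be read as one over the old domain.\<close>

lemma sat_quot:
  assumes "sorted_subst \<L> oa"
  shows "range da \<subseteq> dom I \<Longrightarrow> wf_form \<L> \<phi> \<Longrightarrow> no_obj_quant \<phi> \<Longrightarrow>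
    sat \<L> quot \<phi> oa (\<lambda>x. rep (da x)) = sat \<L> I \<phi> oa da"
proof (induction \<phi> arbitrary: da)
  case (FAtom a)
  then show ?case using sat_atom_quot[OF assms] by simp
next
  case (FAll x \<phi>)
  have "sat \<L> quot \<phi> oa ((\<lambda>y. rep (da y))(x := rep d)) = sat \<L> I \<phi> oa (da(x := d))" if "d \<in> dom I" for d
    using FAll.IH[of "da(x := d)"] FAll.prems that by (force simp: fun_upd_def if_distrib[of rep] cong: if_cong)
  then show ?case by simp
next
  case (FEx x \<phi>)
  have "sat \<L> quot \<phi> oa ((\<lambda>y. rep (da y))(x := rep d)) = sat \<L> I \<phi> oa (da(x := d))" if "d \<in> dom I" for d
    using FEx.IH[of "da(x := d)"] FEx.prems that by (force simp: fun_upd_def if_distrib[of rep] cong: if_cong)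
  then show ?case by simp
qed auto

lemma sat_quot_S:
  assumes "\<xi> \<in> S" "sorted_subst \<L> oa" "range da \<subseteq> dom quot"
  shows "sat \<L> quot \<xi> oa da"
proof -
  have da: "range da \<subseteq> dom I" using assms(3) rep_in by fastforce
  \<comment> \<open>An assignment into the quotient consists of representatives already, so it is
    its own image under \<open>rep\<close> and \<open>sat_quot\<close> applies to it.\<close>
  have "rep (da x) = da x" for x
  proof -
    have "da x \<in> rep ` dom I" using assms(3) by auto
    then show ?thesis by auto
  qed
  then show ?thesis
    using sat_quot[OF assms(2) da, of \<xi>] sat_S[OF assms(1,2) da] open_S[OF assms(1)]
    by (simp add: open_sentence_def)
qed

text \<open>The equality rules demand congruence only in domain arguments. For equality on object
  sorts, being an equivalence relation therefore suffices, and no quotient of the expressions is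
  formed.\<close>

lemma eqoI_equiv:
  assumes "i \<le> maxsort \<L>"
  shows "equiv (exprs \<L> i) (eqoI I i)"
proof (rule equivI)
  note q = EqO_equality[OF assms]
  obtain d where "d \<in> dom I" using struct by (auto simp: lang_structure_def)
  then have da: "range (\<lambda>_. d) \<subseteq> dom I" by auto
  \<comment> \<open>All variables of sort \<open>i\<close> are reassigned at once,
    \<open>EVar i x\<close> denoting \<open>g x\<close>; the other sorts keep their
    assignment.\<close>
  have upd: "sorted_subst \<L> (EVar(i := g))" if "range g \<subseteq> exprs \<L> i" for g
    using that sorted_subst_EVar by (auto simp: sorted_subst_def)
  show sub: "eqoI I i \<subseteq> exprs \<L> i \<times> exprs \<L> i"
    using struct assms by (simp add: lang_structure_def)
  show "refl_on (exprs \<L> i) (eqoI I i)"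
  proof (rule refl_onI)
    show "(E, E) \<in> eqoI I i" if "E \<in> exprs \<L> i" for E
      using equality_refl[OF q upd da, of "\<lambda>_. E"] that by auto
  qed
  show "sym (eqoI I i)"
  proof (rule symI)
    show "(F, E) \<in> eqoI I i" if "(E, F) \<in> eqoI I i" for E F
      using equality_sym[OF q upd da, of "\<lambda>x. if x = 0 then E else F"] that sub by auto
  qed
  show "trans (eqoI I i)"
  proof (rule transI)
    show "(E, G) \<in> eqoI I i" if "(E, F) \<in> eqoI I i" "(F, G) \<in> eqoI I i" for E F G
      using equality_trans[OF q upd da, of "\<lambda>x. if x = 0 then E else if x = 1 then F else G"]
        that sub by auto
  qed
qed

end

section \<open>Values of the Skolem functions\<close>

text \<open>Without a suitable element the value is still an element of \<open>D\<close>, which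
  makes Skolem functions total on the domain.\<close>

definition witness :: "'d set \<Rightarrow> ('d \<Rightarrow> bool) \<Rightarrow> 'd" where
  "witness D P = (if \<exists>d\<in>D. P d then SOME d. d \<in> D \<and> P d else SOME d. d \<in> D)"

lemma witness_in: "D \<noteq> {} \<Longrightarrow> witness D P \<in> D"
  by (auto simp: witness_def some_in_eq intro: someI2_ex)

lemma witness_sat: "\<exists>d\<in>D. P d \<Longrightarrow> P (witness D P)"
  by (auto simp: witness_def intro: someI2_ex)

text \<open>
  The value of the Skolem function of the quantifier with number \<open>q\<close> at the arguments \<open>ds\<close>.  The recursion
  mirrors \<^const>\<open>skol\<close>, descending to the quantifier \<open>q\<close>; \<open>e\<close> assigns values to the variables bound
  on the way, and \<open>l\<close> counts the universal ones, so that the next of these gets the value \<open>ds ! l\<close>.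
  Existential variables are assigned witnesses.
\<close>

primrec skolem_value ::
  "('c, 'f, 'p) lang \<Rightarrow> ('c, 'f, 'p, 'd) struct \<Rightarrow> (nat \<Rightarrow> nat \<Rightarrow> 'c exp) \<Rightarrow> 'd list \<Rightarrow> nat \<Rightarrow> bool
     \<Rightarrow> nat \<Rightarrow> nat \<Rightarrow> (nat \<Rightarrow> 'd) \<Rightarrow> ('c, 'f, 'p) form \<Rightarrow> 'd" where
  "skolem_value \<L> I oa ds q b m l e (FAtom a) = (SOME d. d \<in> dom I)"
| "skolem_value \<L> I oa ds q b m l e (FNeg \<phi>) = skolem_value \<L> I oa ds q (\<not> b) m l e \<phi>"
| "skolem_value \<L> I oa ds q b m l e (FAnd \<phi> \<psi>) =
     (if q < m + nquants \<phi> then skolem_value \<L> I oa ds q b m l e \<phi>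
      else skolem_value \<L> I oa ds q b (m + nquants \<phi>) l e \<psi>)"
| "skolem_value \<L> I oa ds q b m l e (FOr \<phi> \<psi>) =
     (if q < m + nquants \<phi> then skolem_value \<L> I oa ds q b m l e \<phi>
      else skolem_value \<L> I oa ds q b (m + nquants \<phi>) l e \<psi>)"
| "skolem_value \<L> I oa ds q b m l e (FImp \<phi> \<psi>) =
     (if q < m + nquants \<phi> then skolem_value \<L> I oa ds q (\<not> b) m l e \<phi>
      else skolem_value \<L> I oa ds q b (m + nquants \<phi>) l e \<psi>)"
| "skolem_value \<L> I oa ds q b m l e (FAll x \<phi>) =
     (if b then skolem_value \<L> I oa ds q b (Suc m) (Suc l) (e(x := ds ! l)) \<phi>
      else let d = witness (dom I) (\<lambda>d. \<not> sat \<L> I \<phi> oa (e(x := d))) in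
        if q = m then d else skolem_value \<L> I oa ds q b (Suc m) l (e(x := d)) \<phi>)"
| "skolem_value \<L> I oa ds q b m l e (FEx x \<phi>) =
     (if b then let d = witness (dom I) (\<lambda>d. sat \<L> I \<phi> oa (e(x := d))) in
        if q = m then d else skolem_value \<L> I oa ds q b (Suc m) l (e(x := d)) \<phi>
      else skolem_value \<L> I oa ds q b (Suc m) (Suc l) (e(x := ds ! l)) \<phi>)"
| "skolem_value \<L> I oa ds q b m l e (FAllO i j \<phi>) = (SOME d. d \<in> dom I)"
| "skolem_value \<L> I oa ds q b m l e (FExO i j \<phi>) = (SOME d. d \<in> dom I)"

text \<open>Only witnesses and default elements are ever returned; the values in \<open>ds\<close>
  and \<open>e\<close> merely influence which ones.\<close>

lemma skolem_value_in:
  "dom I \<noteq> {} \<Longrightarrow> skolem_value \<L> I oa ds q b m l e \<phi> \<in> dom I"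
  by (induction \<phi> arbitrary: b m l e) (simp_all add: witness_in some_in_eq Let_def)

text \<open>A Skolem function sees only the values of the object variables of its sentence. An
  assignment rebuilt from these arguments selects the same witnesses as the original one.\<close>

lemma skolem_value_cong:
  assumes "no_obj_quant \<phi>"
    and "\<And>i j. (i, j) \<in> set (fov \<phi>) \<Longrightarrow> oa i j = oa' i j"
  shows "skolem_value \<L> I oa ds q b m l e \<phi> = skolem_value \<L> I oa' ds q b m l e \<phi>"
  using assms
proof (induction \<phi> arbitrary: b m l e)
  case (FAll x \<phi>)
  have "sat \<L> I \<phi> oa d = sat \<L> I \<phi> oa' d" for d
    by (rule sat_cong) (use FAll.prems in auto)
  moreover have "skolem_value \<L> I oa ds q b m l e \<phi> = skolem_value \<L> I oa' ds q b m l e \<phi>"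
    for b m l e
    by (rule FAll.IH) (use FAll.prems in auto)
  ultimately show ?case by (simp add: Let_def)
next
  case (FEx x \<phi>)
  have "sat \<L> I \<phi> oa d = sat \<L> I \<phi> oa' d" for d
    by (rule sat_cong) (use FEx.prems in auto)
  moreover have "skolem_value \<L> I oa ds q b m l e \<phi> = skolem_value \<L> I oa' ds q b m l e \<phi>"
    for b m l e
    by (rule FEx.IH) (use FEx.prems in auto)
  ultimately show ?case by (simp add: Let_def)
qed auto

section \<open>The structure interpreting the Skolem symbols\<close>

text \<open>In contrast to \<open>skolemised\<close>, the prefix and the formula are kept
  unskolemised: the interpretation of the Skolem symbols of \<xi> is computed from them.\<close>

definition skolem_parts ::
  "('c, 'f, 'p) lang \<Rightarrow> ('c, 'f, 'p) form set \<Rightarrow> ('c, 'f, 'p) form set \<Rightarrow> ('c, 'f, 'p) form set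
     \<Rightarrow> (('c, 'f, 'p) form \<times> nat list \<times> ('c, 'f, 'p) form) set" where
  "skolem_parts \<L> Sp Sn Sb =
       {(\<xi>, xs, \<phi>) | \<xi> n E xs \<phi>. \<xi> \<in> Sp \<and> xi_parts \<L> n E xs \<phi> \<and> \<xi> = xi_pos n E xs \<phi>}
     \<union> {(\<xi>, xs, FNeg \<phi>) | \<xi> n E xs \<phi>. \<xi> \<in> Sn \<and> xi_parts \<L> n E xs \<phi> \<and> \<xi> = xi_neg n E xs \<phi>}
     \<union> {(\<xi>, [], \<xi>) | \<xi>. \<xi> \<in> Sb - eq_axioms \<L>}"

lemma skolemised_eq:
  "skolemised \<L> Sp Sn Sb = (\<lambda>(\<xi>, xs, \<phi>). (\<xi>, skolem_matrix \<xi> xs \<phi>)) ` skolem_parts \<L> Sp Sn Sb"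
  unfolding skolemised_def skolem_parts_def image_Un by (intro arg_cong2[where f = "(\<union>)"]) force+

text \<open>An implication is no universal formula, so the quantifier prefix ends exactly where the
  implication begins.\<close>

lemma foldr_FAll_FImp_eq:
  "foldr FAll xs (FImp \<alpha> \<beta>) = foldr FAll ys (FImp \<gamma> \<delta>) \<Longrightarrow> xs = ys \<and> \<alpha> = \<gamma> \<and> \<beta> = \<delta>"
proof (induction xs arbitrary: ys)
  case Nil
  then show ?case by (cases ys) auto
next
  case (Cons x xs)
  then show ?case by (cases ys) auto
qed

text \<open>A single sentence may have the shape of both \<open>xi_pos\<close> and
  \<open>xi_neg\<close>; disjointness of the three sets decides which reading counts. Then prefix
  and body can be read off, so a Skolem symbol has only one meaning.\<close>

lemma skolem_parts_unique:
  assumes "Sp \<inter> Sn = {}" "Sp \<inter> Sb = {}" "Sn \<inter> Sb = {}"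
    and "(\<xi>, p) \<in> skolem_parts \<L> Sp Sn Sb" "(\<xi>, p') \<in> skolem_parts \<L> Sp Sn Sb"
  shows "p = p'"
  using assms unfolding skolem_parts_def xi_pos_def xi_neg_def
  by (auto dest!: foldr_FAll_FImp_eq)

text \<open>The arguments of a Skolem symbol are decoded: \<open>Es\<close> lists the values of the
  object variables of \<xi>, and the first entries of \<open>ds\<close> are the values of the outer
  variables \<open>xs\<close>. Accordingly the counter of consumed entries starts at
  \<open>length xs\<close>, and quantifiers are numbered from the same start as in
  \<open>skolem_matrix\<close>.\<close>

definition skolem_struct ::
  "('c, 'f, 'p) lang \<Rightarrow> (('c, 'f, 'p) form \<times> nat list \<times> ('c, 'f, 'p) form) set \<Rightarrow> 'd
     \<Rightarrow> ('c, 'f, 'p, 'd) struct \<Rightarrow> ('c, ('c, 'f, 'p) sfun, 'p, 'd) struct" where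
  "skolem_struct \<L> Ps a I =
     \<lparr>dom = dom I, nu0I = nu0I I, nuI = nuI I,
      fnI = (\<lambda>f Es ds. case f of
         Orig g \<Rightarrow> fnI I g Es ds
       | Skol \<xi> q is k \<Rightarrow>
           (let (xs, \<phi>) = (SOME p. (\<xi>, p) \<in> Ps) in
            skolem_value \<L> I (\<lambda>i j. the (map_of (zip (remdups (fov \<xi>)) Es) (i, j))) ds q True
              (Suc (Max (insert 0 (set xs)))) (length xs) (\<lambda>x. the (map_of (zip xs ds) x)) \<phi>)
       | Root \<Rightarrow> a),
      prI = prI I, eqoI = eqoI I, eqdI = eqdI I\<rparr>"

lemma skolem_struct_simps [simp]:
  "dom (skolem_struct \<L> Ps a I) = dom I" "nu0I (skolem_struct \<L> Ps a I) = nu0I I"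
  "nuI (skolem_struct \<L> Ps a I) = nuI I" "prI (skolem_struct \<L> Ps a I) = prI I"
  "eqoI (skolem_struct \<L> Ps a I) = eqoI I" "eqdI (skolem_struct \<L> Ps a I) = eqdI I"
  "fnI (skolem_struct \<L> Ps a I) (Orig g) Es ds = fnI I g Es ds"
  "fnI (skolem_struct \<L> Ps a I) Root Es ds = a"
  by (simp_all add: skolem_struct_def)

lemma tm_val_skolem_struct:
  assumes "\<And>x. x \<in> set (dv_tm u) \<Longrightarrow> tm_val (skolem_struct \<L> Ps a I) oa w (t x) = e x"
  shows "tm_val (skolem_struct \<L> Ps a I) oa w (tsubst EVar t (map_tm id Orig u)) = tm_val I oa e u"
  using assms
proof (induction u)
  case (Fn f Es ts)
  have "tm_val (skolem_struct \<L> Ps a I) oa w (tsubst EVar t (map_tm id Orig u)) = tm_val I oa e u"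
    if "u \<in> set ts" for u
    using Fn.IH[OF that] Fn.prems that by fastforce
  then have ts: "map (tm_val (skolem_struct \<L> Ps a I) oa w) (map (tsubst EVar t) (map (map_tm id Orig) ts))
      = map (tm_val I oa e) ts"
    by simp
  have Es: "map (esubst oa) (map (esubst EVar) (map (map_exp id) Es)) = map (esubst oa) Es"
    by (simp add: exp.map_id)
  show ?case by (simp only: tm.map tsubst.simps tm_val.simps ts Es skolem_struct_simps)
qed (auto simp: exp.map_id)

text \<open>The invariant behind Skolemisation: if the term \<open>t x\<close> put in for
  \<open>x\<close> denotes \<open>e x\<close>, then the substituted atom under \<open>w\<close> has
  the same truth value as the original one under \<open>e\<close>. Original symbols keep their
  meaning.\<close>

lemma sat_atom_skolem_struct:
  assumes "\<And>x. x \<in> set (dv_atom u) \<Longrightarrow> tm_val (skolem_struct \<L> Ps a I) oa w (t x) = e x"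
  shows "sat_atom (skolem_struct \<L> Ps a I) oa w (asubst EVar t (map_atom id Orig id u)) = sat_atom I oa e u"
proof -
  let ?J = "skolem_struct \<L> Ps a I"
  have *: "map (tm_val ?J oa w) (map (tsubst EVar t) (map (map_tm id Orig) ts)) = map (tm_val I oa e) ts"
    if "\<And>x s. s \<in> set ts \<Longrightarrow> x \<in> set (dv_tm s) \<Longrightarrow> tm_val ?J oa w (t x) = e x" for ts
    using that by (simp add: tm_val_skolem_struct)
  show ?thesis
  proof (cases u)
    case (Nu n E ts)
    with * [of ts] assms show ?thesis by (fastforce simp: exp.map_id simp del: map_map)
  next
    case (Pred P ts)
    with * [of ts] assms show ?thesis by (fastforce simp del: map_map)
  next
    case (EqO i E F)
    then show ?thesis by (simp add: exp.map_id)
  next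
    case (EqD s s')
    with assms show ?thesis by (simp add: tm_val_skolem_struct)
  qed
qed

lemma tm_val_sk_term:
  "tm_val J oa w (sk_term \<xi> m us)
     = fnI J (Skol \<xi> m (map fst (remdups (fov \<xi>))) (length us))
         (map (\<lambda>(i, j). oa i j) (remdups (fov \<xi>))) (map w us)"
  by (simp add: sk_term_def Let_def comp_def case_prod_beta')

text \<open>
  The list \<open>rest\<close> accounts for universal quantifiers in the scope of \<open>\<phi>\<close>: a Skolem function
  belonging to a deeper quantifier also takes the values of their variables.
\<close>

lemma peval_skol:
  assumes J: "J = skolem_struct \<L> Ps a I"
    and "no_obj_quant \<phi>" and w: "range w \<subseteq> dom I"
    and "\<And>q rest is k. m \<le> q \<Longrightarrow> q < m + nquants \<phi> \<Longrightarrow>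
      fnI J (Skol \<xi> q is k) (map (\<lambda>(i, j). oa i j) (remdups (fov \<xi>))) (map w us @ rest)
        = skolem_value \<L> I oa (map w us @ rest) q b m (length us) e \<phi>"
    and "\<And>x. x \<in> set (fdv \<phi>) \<Longrightarrow> tm_val J oa w (t x) = e x"
    and "sat \<L> I \<phi> oa e = b"
  shows "peval (sat_atom J oa w) (skol \<xi> b m us t \<phi>) = b"
  using assms(2,4-)
proof (induction \<phi> arbitrary: b m us t e)
  case (FAtom u)
  then show ?case using sat_atom_skolem_struct[of u \<L> Ps a I oa w t e] by (simp add: J)
next
  case (FNeg \<phi>)
  have "peval (sat_atom J oa w) (skol \<xi> (\<not> b) m us t \<phi>) = (\<not> b)"
    by (rule FNeg.IH[where e = e]) (use FNeg.prems in auto)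
  then show ?case by simp
next
  case (FAnd \<phi> \<psi>)
  \<comment> \<open>Only subformulas that have the value \<open>b\<close> are followed: a false
    conjunction may have just one false conjunct, and nothing is claimed about the other.\<close>
  have "peval (sat_atom J oa w) (skol \<xi> b m us t \<phi>) = b" if "sat \<L> I \<phi> oa e = b"
    by (rule FAnd.IH(1)[where e = e]) (use FAnd.prems that in auto)
  moreover have "peval (sat_atom J oa w) (skol \<xi> b (m + nquants \<phi>) us t \<psi>) = b"
    if "sat \<L> I \<psi> oa e = b"
    by (rule FAnd.IH(2)[where e = e]) (use FAnd.prems that in auto)
  ultimately show ?case using FAnd.prems(4) by auto
next
  case (FOr \<phi> \<psi>)
  have "peval (sat_atom J oa w) (skol \<xi> b m us t \<phi>) = b" if "sat \<L> I \<phi> oa e = b"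
    by (rule FOr.IH(1)[where e = e]) (use FOr.prems that in auto)
  moreover have "peval (sat_atom J oa w) (skol \<xi> b (m + nquants \<phi>) us t \<psi>) = b"
    if "sat \<L> I \<psi> oa e = b"
    by (rule FOr.IH(2)[where e = e]) (use FOr.prems that in auto)
  ultimately show ?case using FOr.prems(4) by auto
next
  case (FImp \<phi> \<psi>)
  have "peval (sat_atom J oa w) (skol \<xi> (\<not> b) m us t \<phi>) = (\<not> b)" if "sat \<L> I \<phi> oa e = (\<not> b)"
    by (rule FImp.IH(1)[where e = e]) (use FImp.prems that in auto)
  moreover have "peval (sat_atom J oa w) (skol \<xi> b (m + nquants \<phi>) us t \<psi>) = b"
    if "sat \<L> I \<psi> oa e = b"
    by (rule FImp.IH(2)[where e = e]) (use FImp.prems that in auto)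
  ultimately show ?case using FImp.prems(4) by auto
next
  case (FAll x \<phi>)
  show ?case
  proof (cases b)
    case True
    have "w m \<in> dom I" using w by auto
    then have wm: "sat \<L> I \<phi> oa (e(x := w m)) = b" using FAll.prems(4) True by (auto simp del: fun_upd_apply)
    have "peval (sat_atom J oa w) (skol \<xi> b (Suc m) (us @ [m]) (t(x := DV m)) \<phi>) = b"
    proof (rule FAll.IH[where e = "e(x := w m)"])
      \<comment> \<open>The value \<open>w m\<close> moves from the head of the remaining arguments
        to the end of those for \<open>us\<close>. This is entry \<open>length us\<close>, which
        \<open>skolem_value\<close> reads for the variable \<open>x\<close>.\<close>
      fix q rest "is" k
      assume "Suc m \<le> q" "q < Suc m + nquants \<phi>"
      then show "fnI J (Skol \<xi> q is k) (map (\<lambda>(i, j). oa i j) (remdups (fov \<xi>))) (map w (us @ [m]) @ rest)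
          = skolem_value \<L> I oa (map w (us @ [m]) @ rest) q b (Suc m) (length (us @ [m])) (e(x := w m)) \<phi>"
        using FAll.prems(2)[of q "is" k "w m # rest"] True by (simp add: nth_append)
    next
      show "tm_val J oa w ((t(x := DV m)) y) = (e(x := w m)) y" if "y \<in> set (fdv \<phi>)" for y
        using FAll.prems(3)[of y] that by auto
    qed (use FAll.prems(1) in simp, rule wm)
    then show ?thesis using True by simp
  next
    case False
    \<comment> \<open>The witness that \<open>skolem_value\<close> assigns to \<open>x\<close>; it
      falsifies the body because the universal formula is false.\<close>
    define d where "d = witness (dom I) (\<lambda>d. \<not> sat \<L> I \<phi> oa (e(x := d)))"
    have d: "sat \<L> I \<phi> oa (e(x := d)) = b"
      using witness_sat[of "dom I" "\<lambda>d. \<not> sat \<L> I \<phi> oa (e(x := d))"] FAll.prems(4) False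
      by (simp add: d_def)
    have "peval (sat_atom J oa w) (skol \<xi> b (Suc m) us (t(x := sk_term \<xi> m us)) \<phi>) = b"
    proof (rule FAll.IH[where e = "e(x := d)"])
      fix q rest "is" k
      assume "Suc m \<le> q" "q < Suc m + nquants \<phi>"
      then show "fnI J (Skol \<xi> q is k) (map (\<lambda>(i, j). oa i j) (remdups (fov \<xi>))) (map w us @ rest)
          = skolem_value \<L> I oa (map w us @ rest) q b (Suc m) (length us) (e(x := d)) \<phi>"
        using FAll.prems(2)[of q "is" k rest] False by (simp add: d_def Let_def)
    next
      \<comment> \<open>For \<open>q = m\<close> and no further arguments
        \<open>skolem_value\<close> stops at this quantifier and returns \<open>d\<close>, so the
        Skolem term denotes \<open>d\<close>.\<close>
      fix y
      assume "y \<in> set (fdv \<phi>)"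
      then show "tm_val J oa w ((t(x := sk_term \<xi> m us)) y) = (e(x := d)) y"
        using FAll.prems(2)[of m _ _ "[]"] FAll.prems(3)[of y] False
        by (auto simp: tm_val_sk_term d_def Let_def)
    qed (use FAll.prems(1) in simp, rule d)
    then show ?thesis using False by simp
  qed
next
  case (FEx x \<phi>)
  show ?case
  proof (cases b)
    case False
    have "w m \<in> dom I" using w by auto
    then have wm: "sat \<L> I \<phi> oa (e(x := w m)) = b" using FEx.prems(4) False by (auto simp del: fun_upd_apply)
    have "peval (sat_atom J oa w) (skol \<xi> b (Suc m) (us @ [m]) (t(x := DV m)) \<phi>) = b"
    proof (rule FEx.IH[where e = "e(x := w m)"])
      fix q rest "is" k
      assume "Suc m \<le> q" "q < Suc m + nquants \<phi>"
      then show "fnI J (Skol \<xi> q is k) (map (\<lambda>(i, j). oa i j) (remdups (fov \<xi>))) (map w (us @ [m]) @ rest)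
          = skolem_value \<L> I oa (map w (us @ [m]) @ rest) q b (Suc m) (length (us @ [m])) (e(x := w m)) \<phi>"
        using FEx.prems(2)[of q "is" k "w m # rest"] False by (simp add: nth_append)
    next
      show "tm_val J oa w ((t(x := DV m)) y) = (e(x := w m)) y" if "y \<in> set (fdv \<phi>)" for y
        using FEx.prems(3)[of y] that by auto
    qed (use FEx.prems(1) in simp, rule wm)
    then show ?thesis using False by simp
  next
    case True
    define d where "d = witness (dom I) (\<lambda>d. sat \<L> I \<phi> oa (e(x := d)))"
    have d: "sat \<L> I \<phi> oa (e(x := d)) = b"
      using witness_sat[of "dom I" "\<lambda>d. sat \<L> I \<phi> oa (e(x := d))"] FEx.prems(4) True
      by (simp add: d_def)
    have "peval (sat_atom J oa w) (skol \<xi> b (Suc m) us (t(x := sk_term \<xi> m us)) \<phi>) = b"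
    proof (rule FEx.IH[where e = "e(x := d)"])
      fix q rest "is" k
      assume "Suc m \<le> q" "q < Suc m + nquants \<phi>"
      then show "fnI J (Skol \<xi> q is k) (map (\<lambda>(i, j). oa i j) (remdups (fov \<xi>))) (map w us @ rest)
          = skolem_value \<L> I oa (map w us @ rest) q b (Suc m) (length us) (e(x := d)) \<phi>"
        using FEx.prems(2)[of q "is" k rest] True by (simp add: d_def Let_def)
    next
      fix y
      assume "y \<in> set (fdv \<phi>)"
      then show "tm_val J oa w ((t(x := sk_term \<xi> m us)) y) = (e(x := d)) y"
        using FEx.prems(2)[of m _ _ "[]"] FEx.prems(3)[of y] True
        by (auto simp: tm_val_sk_term d_def Let_def)
    qed (use FEx.prems(1) in simp, rule d)
    then show ?thesis using True by simp
  qed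
qed auto

lemma peval_skolem_matrix:
  assumes parts: "(\<xi>, xs, \<phi>) \<in> Ps" and unique: "\<And>p. (\<xi>, p) \<in> Ps \<Longrightarrow> p = (xs, \<phi>)"
    and noq: "no_obj_quant \<phi>" and fov: "set (fov \<phi>) \<subseteq> set (fov \<xi>)" and fdv: "set (fdv \<phi>) \<subseteq> set xs"
    and w: "range w \<subseteq> dom I" and sat: "sat \<L> I \<phi> oa w"
  shows "peval (sat_atom (skolem_struct \<L> Ps a I) oa w) (skolem_matrix \<xi> xs \<phi>)"
proof -
  define e where "e = (\<lambda>x. the (map_of (zip xs (map w xs)) x))"
  define ps where "ps = remdups (fov \<xi>)"
  define oa' where "oa' = (\<lambda>i j. the (map_of (zip ps (map (\<lambda>(i, j). oa i j) ps)) (i, j)))"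
  have e: "e x = w x" if "x \<in> set xs" for x
    using that by (simp add: e_def map_of_zip_map)
  have oa': "oa' i j = oa i j" if "(i, j) \<in> set (fov \<xi>)" for i j
    using that by (simp add: oa'_def ps_def map_of_zip_map)
  \<comment> \<open>The choice made in \<open>skolem_struct\<close> finds the intended prefix and
    formula.\<close>
  have "(SOME p. (\<xi>, p) \<in> Ps) = (xs, \<phi>)"
    using parts unique by (intro some_equality)
  \<comment> \<open>Zipping with \<open>xs\<close> stops after the outer variables, so the decoded
    \<open>e\<close> does not depend on \<open>rest\<close>.\<close>
  then have fn: "fnI (skolem_struct \<L> Ps a I) (Skol \<xi> q is k) (map (\<lambda>(i, j). oa i j) ps) (map w xs @ rest)
      = skolem_value \<L> I oa' (map w xs @ rest) q True (Suc (Max (insert 0 (set xs)))) (length xs) e \<phi>"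
    for q "is" k rest
    by (simp add: skolem_struct_def ps_def oa'_def e_def zip_append2)
  have val: "skolem_value \<L> I oa' ds q b m l e' \<phi> = skolem_value \<L> I oa ds q b m l e' \<phi>" for ds q b m l e'
    by (rule skolem_value_cong[OF noq]) (use oa' fov in auto)
  have "sat \<L> I \<phi> oa e = sat \<L> I \<phi> oa w"
    by (rule sat_cong[OF noq]) (use e fdv in auto)
  then have "peval (sat_atom (skolem_struct \<L> Ps a I) oa w)
      (skol \<xi> True (Suc (Max (insert 0 (set xs)))) xs DV \<phi>) = True"
    using sat fn e fdv unfolding val by (intro peval_skol[where e = e, OF refl] noq w) (auto simp: ps_def)
  then show ?thesis by (simp add: skolem_matrix_def)
qed

section \<open>Soundness of single rules\<close>

lemma is_expr_skolem_lang [simp]: "is_expr (skolem_lang \<L> Sp Sn Sb) = is_expr \<L>"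
proof (intro ext iffI)
  show "is_expr \<L> i E" if "is_expr (skolem_lang \<L> Sp Sn Sb) i E" for i E
    using that by induction (auto simp: skolem_lang_def intro: is_expr.intros)
  show "is_expr (skolem_lang \<L> Sp Sn Sb) i E" if "is_expr \<L> i E" for i E
    using that by induction (auto simp: skolem_lang_def intro: is_expr.intros)
qed

lemma maxsort_skolem_lang [simp]: "maxsort (skolem_lang \<L> Sp Sn Sb) = maxsort \<L>"
  by (simp add: skolem_lang_def)

lemma exprs_skolem_lang [simp]: "exprs (skolem_lang \<L> Sp Sn Sb) = exprs \<L>"
  by (simp add: exprs_def fun_eq_iff)

lemma sorted_subst_skolem_lang [simp]:
  "sorted_subst (skolem_lang \<L> Sp Sn Sb) = sorted_subst \<L>"
  by (simp add: sorted_subst_def fun_eq_iff)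

text \<open>Quantifying over all assignments covers all ground instances, since an instantiation can
  be traded for the assignment of its values. For a closure rule the condition says that its
  premises are never true together.\<close>

definition rule_sound ::
  "('c, 'f, 'p) lang \<Rightarrow> ('c, 'f, 'p, 'd) struct
     \<Rightarrow> ('c, 'f, 'p) atom lit set \<times> ('c, 'f, 'p) atom lit set list \<Rightarrow> bool" where
  "rule_sound \<L> J r \<longleftrightarrow> (\<forall>oa w. sorted_subst \<L> oa \<longrightarrow> range w \<subseteq> dom J \<longrightarrow>
     (\<forall>l\<in>fst r. leval (sat_atom J oa w) l) \<longrightarrow>
     (\<exists>X\<in>set (snd r). \<forall>l\<in>X. leval (sat_atom J oa w) l))"

text \<open>A member of \<open>dpreds\<close> is a function on term lists. Its truth depends on
  values only, which is seen case by case; the length matters for \<open>EqD\<close>, which reads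
  the entries 0 and 1.\<close>

lemma dpred_eq:
  assumes "(A, k) \<in> dpreds \<L>" "length ts = k" "map (tm_val J oa w) ts = map (tm_val J oa w) us"
  shows "sat_atom J oa w (A ts) = sat_atom J oa w (A us)"
proof -
  have len: "length us = k" using assms(2) map_eq_imp_length_eq[OF assms(3)] by simp
  have "tm_val J oa w (ts ! j) = tm_val J oa w (us ! j)" if "j < k" for j
    using assms(2) len that arg_cong[OF assms(3), of "\<lambda>vs. vs ! j"] by simp
  then show ?thesis using assms(1,3) by (auto simp: dpreds_def simp del: map_eq_conv)
qed

text \<open>With domain equality the identity, the premise \<open>EqD (DV i) (DV k)\<close> forces
  \<open>w i = w k\<close>, so exchanging these variables changes no value. Thus the congruence
  rules hold for every function symbol, Skolem symbols included.\<close>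

lemma equality_rules_sound:
  assumes eqd: "eqdI J = Id_on (dom J)"
    and eqo: "\<And>i. i \<le> maxsort \<L> \<Longrightarrow> equiv (exprs \<L> i) (eqoI J i)"
    and r: "r \<in> equality_rules \<L>"
  shows "rule_sound \<L> J r"
  unfolding rule_sound_def
proof (intro allI impI)
  fix oa w
  assume oa: "sorted_subst \<L> oa" and w: "range w \<subseteq> dom J"
    and prem: "\<forall>l\<in>fst r. leval (sat_atom J oa w) l"
  have xvars_upd: "map (tm_val J oa w) ((xvars k)[i := DV k]) = map (tm_val J oa w) (xvars k)"
    if "w i = w k" "i < k" for i k
    using that by (auto simp: map_update list_eq_iff_nth_eq nth_list_update)
  have eqo_props: "refl_on (exprs \<L> i) (eqoI J i)" "sym (eqoI J i)" "trans (eqoI J i)"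
    if "i \<le> maxsort \<L>" for i
    using eqo[OF that] by (auto elim: equivE)
  have symm: "sat_atom J oa w (q 1 0)" if "q \<in> equalities \<L>" "sat_atom J oa w (q 0 1)" for q
    using that eqd by (auto simp: equalities_def intro: symD[OF eqo_props(2)])
  have tran: "sat_atom J oa w (q 0 2)"
    if "q \<in> equalities \<L>" "sat_atom J oa w (q 0 1)" "sat_atom J oa w (q 1 2)" for q
    using that eqd by (auto simp: equalities_def intro: transD[OF eqo_props(3)])
  have reflexivity: "\<forall>l\<in>refl_ov (set (ov_atom a)) \<union> refl_dv (set (dv_atom a)). leval (sat_atom J oa w) l"
    if a: "a \<in> pred_atoms \<L>" for a
  proof -
    have "ov_tm t = []" if "t \<in> set (xvars k)" for t :: "('a, 'b) tm" and k
      using that by (auto simp: xvars_def)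
    then have "i \<le> maxsort \<L>" if "(i, j) \<in> set (ov_atom a)" for i j
      using a that by (auto simp: pred_atoms_def dpreds_def xvars_def split: if_splits)
    then have "(oa i j, oa i j) \<in> eqoI J i" if "(i, j) \<in> set (ov_atom a)" for i j
      using oa that by (auto simp: sorted_subst_def intro: refl_onD[OF eqo_props(1)])
    moreover have "(w x, w x) \<in> eqdI J" for x
      using w eqd by auto
    ultimately show ?thesis by (auto simp: refl_ov_def refl_dv_def)
  qed
  consider
    (refl) s a where "r = ({s a}, [refl_ov (set (ov_atom a)) \<union> refl_dv (set (dv_atom a))])"
      "a \<in> pred_atoms \<L>"
  | (sym) q where "r = ({Pos (q 0 1)}, [{Pos (q 1 0)}])" "q \<in> equalities \<L>"
  | (trans) q where "r = ({Pos (q 0 1), Pos (q 1 2)}, [{Pos (q 0 2)}])" "q \<in> equalities \<L>"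
  | (pred) A k i where
      "r = ({Pos (A (xvars k)), Pos (EqD (DV i) (DV k))}, [{Pos (A ((xvars k)[i := DV k]))}])"
      "(A, k) \<in> dpreds \<L>" "i < k"
  | (fn) f "is" k i where
      "r = ({Pos (EqD (Fn f (pvars is) (xvars k)) (Fn f (pvars is) (xvars k))), Pos (EqD (DV i) (DV k))},
         [{Pos (EqD (Fn f (pvars is) (xvars k)) (Fn f (pvars is) ((xvars k)[i := DV k])))}])" "i < k"
    using r unfolding equality_rules_def by blast
  then show "\<exists>X\<in>set (snd r). \<forall>l\<in>X. leval (sat_atom J oa w) l"
  proof cases
    case refl
    then show ?thesis using reflexivity by simp
  next
    case sym
    then show ?thesis using symm[of q] prem by simp
  next
    case trans
    then show ?thesis using tran[of q] prem by simp
  next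
    case (pred A k i)
    then have "w i = w k" "sat_atom J oa w (A (xvars k))" using prem eqd by auto
    then show ?thesis
      using pred dpred_eq[OF pred(2), of "xvars k" J oa w "(xvars k)[i := DV k]"] xvars_upd[of i k]
      by (simp add: xvars_def)
  next
    case (fn f "is" k i)
    then have "w i = w k" using prem eqd by auto
    then show ?thesis using fn prem xvars_upd[of i k] by (simp del: map_xvars)
  qed
qed

lemma closure_rules_sound: "r \<in> closure_rules \<L>' \<Longrightarrow> rule_sound \<L> J r"
  by (auto simp: closure_rules_def rule_sound_def)

section \<open>Following a branch of true nodes\<close>

lemma tm_val_in_dom:
  assumes "\<And>E. nu0I J E \<in> dom J" "\<And>f Es ds. fnI J f Es ds \<in> dom J" "range w \<subseteq> dom J"
  shows "tm_val J oa w t \<in> dom J"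
  using assms by (cases t) auto

text \<open>Under \<open>EVar\<close> object variables denote themselves, so an instantiated literal
  is true exactly if the literal is true when its variables denote the instantiating expressions and
  the values of the instantiating terms.\<close>

lemma leval_linst:
  "leval (sat_atom J EVar w) (linst \<sigma> l)
     = leval (sat_atom J (fst \<sigma>) (\<lambda>x. tm_val J EVar w (snd \<sigma> x))) l"
  by (cases l) (simp_all add: linst_def sat_atom_asubst)

lemma exists_open_branch:
  assumes tab: "is_tableau \<L>' T \<S> t" and root: "P []"
    and step: "\<And>v r \<sigma>. v \<in> nodes t \<Longrightarrow> P v \<Longrightarrow> app t v = Some (r, \<sigma>) \<Longrightarrow> \<exists>k<length (snd r). P (v @ [k])"
  shows "\<exists>B. is_branch t B \<and> \<not> closed_branch t B"
proof -
  \<comment> \<open>At a node without rule application the walk stands still, so finite and infinite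
    branches are both ranges of one sequence \<open>p\<close>.\<close>
  define next_node where
    "next_node v = (if app t v = None then v else v @ [SOME k. v @ [k] \<in> nodes t \<and> P (v @ [k])])" for v
  define p where "p n = (next_node ^^ n) []" for n
  define B where "B = range p"
  have child: "v @ [k] \<in> nodes t \<longleftrightarrow> v \<in> nodes t \<and> (\<exists>r \<sigma>. app t v = Some (r, \<sigma>) \<and> k < length (snd r))" for v k
    using tab unfolding is_tableau_def by blast
  have next_node: "next_node v \<in> nodes t \<and> P (next_node v)" if v: "v \<in> nodes t" "P v" for v
  proof (cases "app t v")
    case (Some a)
    obtain r \<sigma> where a: "a = (r, \<sigma>)" by (rule prod.exhaust)
    obtain k where "k < length (snd r)" "P (v @ [k])" using step[OF v, of r \<sigma>] Some a by auto
    then have "\<exists>k. v @ [k] \<in> nodes t \<and> P (v @ [k])" using child v Some a by blast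
    then have "v @ [SOME k. v @ [k] \<in> nodes t \<and> P (v @ [k])] \<in> nodes t
        \<and> P (v @ [SOME k. v @ [k] \<in> nodes t \<and> P (v @ [k])])"
      by (rule someI_ex)
    then show ?thesis by (simp add: next_node_def Some)
  qed (use v in \<open>simp add: next_node_def\<close>)
  have p_Suc: "p (Suc n) = next_node (p n)" for n by (simp add: p_def)
  have p: "p n \<in> nodes t \<and> P (p n)" for n
    using root tab next_node by (induction n) (auto simp: p_Suc is_tableau_def p_def[of 0])
  have B_prefix: "u \<in> B" if "prefix u (p n)" for u n
    using that
  proof (induction n)
    case 0
    then have "u = p 0" by (simp add: p_def)
    then show ?case by (simp add: B_def)
  next
    case (Suc n)
    show ?case
    proof (cases "u = p (Suc n)")
      case True
      then show ?thesis by (simp add: B_def)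
    next
      case False
      \<comment> \<open>One step of the walk adds at most one entry to the address.\<close>
      then have "prefix u (p n)"
        using Suc.prems by (auto simp: p_Suc next_node_def split: if_splits)
      then show ?thesis by (rule Suc.IH)
    qed
  qed
  have "prefix (next_node v) (next_node v)" "prefix v (next_node v)" for v
    by (auto simp: next_node_def)
  then have mono: "prefix (p m) (p n)" if "m \<le> n" for m n
    using that by (induction n) (auto simp: p_Suc le_Suc_eq intro: prefix_order.trans)
  have path: "is_path t B"
    unfolding is_path_def
  proof (intro conjI ballI allI impI)
    show "B \<subseteq> nodes t" using p by (auto simp: B_def)
    show "u \<in> B" if "v \<in> B" "prefix u v" for u v using that B_prefix by (auto simp: B_def)
    show "prefix u v \<or> prefix v u" if "u \<in> B" "v \<in> B" for u v
      using that mono by (auto simp: B_def) (metis nat_le_linear)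
  qed
  have "B' = B" if B': "is_path t B'" "B \<subseteq> B'" for B'
  proof -
    have "u \<in> B" if "u \<in> B'" for u
      using that
    \<comment> \<open>Maximality: if a larger path leaves \<open>p n\<close> towards a child, a rule
      is applied there, so the walk moves on to a child too. Both children lie on one path and are
      comparable; having equal length, they coincide.\<close>
    proof (induction u rule: rev_induct)
      case Nil
      show ?case by (rule B_prefix[of _ 0]) simp
    next
      case (snoc k v)
      then have "v \<in> B'" using B'(1) unfolding is_path_def by (meson prefix_snoc prefix_order.refl)
      then obtain n where n: "v = p n" using snoc.IH by (auto simp: B_def)
      have "v @ [k] \<in> nodes t" using snoc.prems B'(1) by (auto simp: is_path_def)
      then obtain j where j: "p (Suc n) = v @ [j]"
        using child n by (auto simp: p_Suc next_node_def)
      have "p (Suc n) \<in> B" by (simp add: B_def)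
      then have "prefix (v @ [k]) (v @ [j]) \<or> prefix (v @ [j]) (v @ [k])"
        using B' snoc.prems j unfolding is_path_def by (metis subsetD)
      then have "v @ [k] = p (Suc n)" using j by auto
      then show ?case by (simp add: B_def)
    qed
    then show ?thesis using B'(2) by blast
  qed
  then have "is_branch t B" using path by (simp add: is_branch_def)
  moreover have "\<not> closed_branch t B"
    \<comment> \<open>A closure rule has no denominators, whereas \<open>step\<close> provides one
      at every true node where a rule is applied.\<close>
    using step p by (fastforce simp: closed_branch_def B_def)
  ultimately show ?thesis by blast
qed

lemma open_if_rules_sound:
  fixes J :: "('c, ('c, 'f, 'p) sfun, 'p, 'd) struct" and w :: "nat \<Rightarrow> 'd"
  assumes tab: "is_tableau \<L>' T \<S> t"
    and sound: "\<And>r. r \<in> T \<Longrightarrow> rule_sound \<L>' J r"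
    and closed: "\<And>E. nu0I J E \<in> dom J" "\<And>f Es ds. fnI J f Es ds \<in> dom J"
    and w: "range w \<subseteq> dom J"
    and root: "\<And>C. C \<in> \<S> \<Longrightarrow> (C, [fnI J Root [] []]) \<in> nuI J 1"
  shows "open_tableau t"
proof -
  \<comment> \<open>The invariant of the walk: all literals of the label are true, with object
    variables denoting themselves.\<close>
  define P where "P v \<longleftrightarrow> (\<forall>l\<in>lab t v. leval (sat_atom J EVar w) l)" for v
  have "\<exists>B. is_branch t B \<and> \<not> closed_branch t B"
  proof (rule exists_open_branch[OF tab])
    have "lab t [] = root_label \<S>" using tab by (simp add: is_tableau_def)
    then show "P []" using root by (auto simp: P_def root_label_def)
  next
    fix v r \<sigma>
    assume v: "v \<in> nodes t" "P v" "app t v = Some (r, \<sigma>)"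
    then have r: "r \<in> T" "ground_inst \<L>' \<sigma>" "linst \<sigma> ` fst r \<subseteq> lab t v"
      and lab: "\<And>k. k < length (snd r) \<Longrightarrow> lab t (v @ [k]) = lab t v \<union> linst \<sigma> ` (snd r ! k)"
      using tab unfolding is_tableau_def by blast+
    define w' where "w' = (\<lambda>x. tm_val J EVar w (snd \<sigma> x))"
    have "range w' \<subseteq> dom J" using tm_val_in_dom[OF closed w] by (auto simp: w'_def)
    moreover have "\<forall>l\<in>fst r. leval (sat_atom J (fst \<sigma>) w') l"
      using v(2) r(3) by (force simp: P_def w'_def simp flip: leval_linst)
    moreover have "sorted_subst \<L>' (fst \<sigma>)" using r(2) by (simp add: ground_inst_def)
    ultimately obtain X where X: "X \<in> set (snd r)" "\<forall>l\<in>X. leval (sat_atom J (fst \<sigma>) w') l"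
      using sound[OF r(1)] unfolding rule_sound_def by blast
    then obtain k where k: "k < length (snd r)" "snd r ! k = X" by (auto simp: in_set_conv_nth)
    have "P (v @ [k])"
      using v(2) X(2) k lab[OF k(1)] by (auto simp: P_def w'_def leval_linst)
    then show "\<exists>k<length (snd r). P (v @ [k])" using k by blast
  qed
  then show ?thesis by (auto simp: closed_tableau_def)
qed

section \<open>Soundness of the generated calculus\<close>

lemma foldr_FAll_simps [simp]:
  "fov (foldr FAll xs \<phi>) = fov \<phi>" "no_obj_quant (foldr FAll xs \<phi>) = no_obj_quant \<phi>"
  by (induction xs) auto

text \<open>The two sides use \<open>nu_atom\<close> over different function symbols. Apart from
  \<open>Nu0\<close>, whose meaning is kept, this atom contains no function symbol.\<close>

lemma sat_atom_nu_atom: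
  "sat_atom (skolem_struct \<L> Ps a I) oa w (nu_atom n E xs) = sat_atom I oa w (nu_atom n E xs)"
  by (simp add: nu_atom_def comp_def)

locale normalised_model = equality_model \<L> S I
  for \<L> :: "('c, 'f, 'p) lang" and S and I :: "('c, 'f, 'p, 'd) struct" +
  fixes Sp Sn Sb
  assumes norm: "normalised \<L> S Sp Sn Sb" and maxsort: "1 \<le> maxsort \<L>"
begin

abbreviation parts :: "(('c, 'f, 'p) form \<times> nat list \<times> ('c, 'f, 'p) form) set" where
  "parts \<equiv> skolem_parts \<L> Sp Sn Sb"

abbreviation skolem_model :: "'d \<Rightarrow> ('c, ('c, 'f, 'p) sfun, 'p, 'd) struct" where
  "skolem_model a \<equiv> skolem_struct \<L> parts (rep a) quot"

lemma parts_wf: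
  assumes "(\<xi>, xs, \<phi>) \<in> parts"
  shows "\<xi> \<in> S" "no_obj_quant \<phi>" "set (fov \<phi>) \<subseteq> set (fov \<xi>)" "set (fdv \<phi>) \<subseteq> set xs"
proof -
  show \<xi>: "\<xi> \<in> S" using assms norm by (auto simp: skolem_parts_def normalised_def)
  show "no_obj_quant \<phi>" "set (fov \<phi>) \<subseteq> set (fov \<xi>)" "set (fdv \<phi>) \<subseteq> set xs"
    using assms open_S[OF \<xi>]
    by (auto simp: skolem_parts_def open_sentence_def xi_parts_def xi_pos_def xi_neg_def)
qed

lemma sat_skolem_matrix:
  assumes "(\<xi>, xs, \<phi>) \<in> parts" "range w \<subseteq> dom quot" "sat \<L> quot \<phi> oa w"
  shows "peval (sat_atom (skolem_model a) oa w) (skolem_matrix \<xi> xs \<phi>)"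
proof (rule peval_skolem_matrix[OF assms(1) _ parts_wf(2-4)[OF assms(1)] assms(2,3)])
  show "p = (xs, \<phi>)" if "(\<xi>, p) \<in> parts" for p
    using norm that assms(1) by (intro skolem_parts_unique) (auto simp: normalised_def)
qed

lemma calculus_sound:
  assumes calc: "generated_calculus \<L> Sp Sn Sb T" and r: "r \<in> T"
  shows "rule_sound (skolem_lang \<L> Sp Sn Sb) (skolem_model a) r"
proof -
  let ?J = "skolem_model a" and ?\<L>' = "skolem_lang \<L> Sp Sn Sb"
  obtain D where D: "\<And>\<xi> \<psi>. (\<xi>, \<psi>) \<in> skolemised \<L> Sp Sn Sb \<Longrightarrow> disjunctive_form (D \<xi>) \<psi>"
    and T: "T = pos_rules \<L> Sp D \<union> neg_rules \<L> Sn D \<union> background_rules \<L> Sb D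
         \<union> equality_rules ?\<L>' \<union> closure_rules ?\<L>'"
    using calc unfolding generated_calculus_def by blast
  \<comment> \<open>Common pattern of the rules generated from sentences: \<xi> holds in the
    quotient, the premises reduce it to the part that was Skolemised, the matrix of this part is
    then true, and so is one disjunct of its disjunctive form.\<close>
  have main: "rule_sound ?\<L>' ?J (X, D \<xi>)"
    if parts: "(\<xi>, xs, \<phi>) \<in> parts"
      and sat: "\<And>oa w. sorted_subst \<L> oa \<Longrightarrow> range w \<subseteq> dom quot \<Longrightarrow>
        \<forall>l\<in>X. leval (sat_atom ?J oa w) l \<Longrightarrow> sat \<L> quot \<xi> oa w \<Longrightarrow> sat \<L> quot \<phi> oa w"
    for \<xi> xs \<phi> X
    unfolding rule_sound_def
  proof (intro allI impI)
    fix oa w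
    assume "sorted_subst ?\<L>' oa" and w: "range w \<subseteq> dom ?J"
      and X: "\<forall>l\<in>fst (X, D \<xi>). leval (sat_atom ?J oa w) l"
    then have oa: "sorted_subst \<L> oa" by simp
    have w': "range w \<subseteq> dom quot" using w by simp
    have "sat \<L> quot \<phi> oa w"
      using sat[OF oa w'] X sat_quot_S[OF parts_wf(1)[OF parts] oa w'] by simp
    then have "peval (sat_atom ?J oa w) (skolem_matrix \<xi> xs \<phi>)"
      by (rule sat_skolem_matrix[OF parts w'])
    moreover have "(\<xi>, skolem_matrix \<xi> xs \<phi>) \<in> skolemised \<L> Sp Sn Sb"
      using parts by (force simp: skolemised_eq)
    ultimately show "\<exists>X\<in>set (snd (X, D \<xi>)). \<forall>l\<in>X. leval (sat_atom ?J oa w) l"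
      using D by (auto simp: disjunctive_form_def)
  qed
  consider "r \<in> pos_rules \<L> Sp D" | "r \<in> neg_rules \<L> Sn D" | "r \<in> background_rules \<L> Sb D"
    | "r \<in> equality_rules ?\<L>'" | "r \<in> closure_rules ?\<L>'"
    using r T by blast
  then show ?thesis
  proof cases
    case 1
    then obtain n E xs \<phi> where *: "xi_parts \<L> n E xs \<phi>" "xi_pos n E xs \<phi> \<in> Sp"
      and r: "r = (insert (Pos (nu_atom n E xs)) (refl_dv (dvs (D (xi_pos n E xs \<phi>)) - set xs)),
        D (xi_pos n E xs \<phi>))"
      unfolding pos_rules_def by blast
    show ?thesis
      unfolding r
    proof (rule main)
      show "(xi_pos n E xs \<phi>, xs, \<phi>) \<in> parts" using * by (auto simp: skolem_parts_def)
    next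
      fix oa w
      assume w: "range w \<subseteq> dom quot" and sat: "sat \<L> quot (xi_pos n E xs \<phi>) oa w"
        and X: "\<forall>l\<in>insert (Pos (nu_atom n E xs)) (refl_dv (dvs (D (xi_pos n E xs \<phi>)) - set xs)).
          leval (sat_atom ?J oa w) l"
      show "sat \<L> quot \<phi> oa w"
        \<comment> \<open>The outer variables are instantiated with their values under
          \<open>w\<close>; the main premise then yields the consequent.\<close>
        using sat_foldr_FAll[OF sat[unfolded xi_pos_def] w] X by (auto simp: sat_atom_nu_atom)
    qed
  next
    case 2
    then obtain n E xs \<phi> where *: "xi_parts \<L> n E xs \<phi>" "xi_neg n E xs \<phi> \<in> Sn"
      and r: "r = (insert (Neg (nu_atom n E xs)) (refl_dv (dvs (D (xi_neg n E xs \<phi>)) - set xs)),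
        D (xi_neg n E xs \<phi>))"
      unfolding neg_rules_def by blast
    show ?thesis
      unfolding r
    proof (rule main)
      show "(xi_neg n E xs \<phi>, xs, FNeg \<phi>) \<in> parts" using * by (auto simp: skolem_parts_def)
    next
      fix oa w
      assume w: "range w \<subseteq> dom quot" and sat: "sat \<L> quot (xi_neg n E xs \<phi>) oa w"
        and X: "\<forall>l\<in>insert (Neg (nu_atom n E xs)) (refl_dv (dvs (D (xi_neg n E xs \<phi>)) - set xs)).
          leval (sat_atom ?J oa w) l"
      show "sat \<L> quot (FNeg \<phi>) oa w"
        using sat_foldr_FAll[OF sat[unfolded xi_neg_def] w] X by (auto simp: sat_atom_nu_atom)
    qed
  next
    case 3
    then obtain \<xi> where "\<xi> \<in> Sb - eq_axioms \<L>"
      and r: "r = (refl_ov (ovs (D \<xi>)) \<union> refl_dv (dvs (D \<xi>)), D \<xi>)"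
      unfolding background_rules_def by blast
    then have "(\<xi>, [], \<xi>) \<in> parts" by (auto simp: skolem_parts_def)
    \<comment> \<open>Here the whole sentence is Skolemised, so the implication required by
      \<open>main\<close> is trivial.\<close>
    then show ?thesis unfolding r by (rule main)
  next
    case 4
    then show ?thesis
      by (intro equality_rules_sound) (use eqoI_equiv in auto)
  next
    case 5
    then show ?thesis by (rule closure_rules_sound)
  qed
qed

lemma tableau_open:
  assumes calc: "generated_calculus \<L> Sp Sn Sb T" and sat: "satisfiable_in \<S> I"
    and tab: "is_tableau (skolem_lang \<L> Sp Sn Sb) T \<S> t"
  shows "open_tableau t"
proof -
  obtain a where a: "a \<in> dom I" "\<And>C. C \<in> \<S> \<Longrightarrow> (C, [a]) \<in> nuI I 1"
    using sat by (auto simp: satisfiable_in_def)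
  have ne: "dom quot \<noteq> {}" using a by auto
  show ?thesis
  proof (rule open_if_rules_sound[OF tab calculus_sound[OF calc]])
    show "nu0I (skolem_model a) E \<in> dom (skolem_model a)" for E
      using rep_in_image by simp
    show "fnI (skolem_model a) f Es ds \<in> dom (skolem_model a)" for f Es ds
    proof (cases f)
      case (Skol \<xi> q "is" k)
      then show ?thesis
        using skolem_value_in[OF ne] by (simp add: skolem_struct_def Let_def split: prod.split)
    qed (use rep_in_image in simp_all)
    show "range (\<lambda>_. rep a) \<subseteq> dom (skolem_model a)" using rep_in_image by auto
    show "(C, [fnI (skolem_model a) Root [] []]) \<in> nuI (skolem_model a) 1" if "C \<in> \<S>" for C
    proof -
      \<comment> \<open>\<open>Root\<close> denotes the representative of \<open>a\<close>, which
        satisfies the same concepts as \<open>a\<close> by congruence of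
        \<open>Nu 1\<close>.\<close>
      have "(C, [rep a]) \<in> nuI I 1"
        using nu_cong[OF _ maxsort a(2)[OF that], of "[rep a]"] rep_eqd[OF a(1)] by simp
      then show ?thesis by simp
    qed
  qed
qed

end

theorem theorem5p1:
  fixes \<L> :: "('c, 'f, 'p) lang"
    and L :: "'c exp set"
    and S\<^sub>L Sp Sn Sb :: "('c, 'f, 'p) form set"
    and T\<^sub>L :: "('c, 'f, 'p) rule set"
  assumes "language \<L>"
    and "is_logic \<L> L"
    and "specification_of TYPE('d) \<L> S\<^sub>L L"
    and "normalised \<L> S\<^sub>L Sp Sn Sb"
    and "generated_calculus \<L> Sp Sn Sb T\<^sub>L"
  shows "\<forall>\<S>\<subseteq>concepts \<L>.
    (\<exists>I :: ('c, 'f, 'p, 'd) struct. spec_model \<L> S\<^sub>L I \<and> satisfiable_in \<S> I) \<longrightarrow>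
    (\<forall>t. finished_tableau (skolem_lang \<L> Sp Sn Sb) T\<^sub>L \<S> t \<longrightarrow> open_tableau t)"
proof (intro allI impI)
  fix \<S> and t :: "('c, 'f, 'p) tableau"
  assume "\<exists>I :: ('c, 'f, 'p, 'd) struct. spec_model \<L> S\<^sub>L I \<and> satisfiable_in \<S> I"
    and fin: "finished_tableau (skolem_lang \<L> Sp Sn Sb) T\<^sub>L \<S> t"
  then obtain I :: "('c, 'f, 'p, 'd) struct"
    where I: "spec_model \<L> S\<^sub>L I" "satisfiable_in \<S> I" by blast
  interpret normalised_model \<L> S\<^sub>L I Sp Sn Sb
    using assms(1,3,4) I(1)
    by unfold_locales (auto simp: language_def specification_of_def semantic_specification_def)
  show "open_tableau t"
    using tableau_open[OF assms(5) I(2)] fin by (simp add: finished_tableau_def)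
qed

end
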